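(* Let $M$ be a compact Hausdorff space such that $C(M)$ is approximately diagonal (AD). Then $\dim M\le 2$ and $\mathrm{H}^2(M,\mathbb Z)\cong 0$.
   Context: $C(M)$ is the unital $C^*$-algebra of continuous complex-valued functions on $M$. For a unital $C^*$-algebra $\mathcal A$, $\mathrm{M}_n(\mathcal A)$ is the $C^*$-algebra of $n\times n$ matrices over $\mathcal A$ and $U_n(\mathcal A)$ is its unitary group. An element $A\in \mathrm{M}_n(\mathcal A)$ ($n\ge 2$) is approximately diagonalizable if for every $\epsilon>0$ there are $U\in U_n(\mathcal A)$ and $a_1,\dots,a_n\in\mathcal A$ such that $\|UAU^*-\mathrm{diag}(a_1,\dots,a_n)\|<\epsilon$. The algebra $\mathcal A$ is approximately diagonal (AD) if for every $n\ge 2$ every self-adjoint element of $\mathrm{M}_n(\mathcal A)$ is approximately diagonalizable. $\dim M$ is the covering dimension; for a compact Hausdorff space, $\dim M\le n$ iff for every closed subset $A\subset M$ every continuous map $A\to \mathbf{S}^n$ (the $n$-sphere) extends continuously to $M$. $\mathrm{H}^n(M,\mathbb Z)$ is the $n$-th Čech cohomology group of $M$ with integer coefficients. *)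

theory Defs
  imports
    "HOL-Analysis.T1_Spaces"
    "HOL-Algebra.Elementary_Groups"
    "Jordan_Normal_Form.Schur_Decomposition"
begin

section \<open>Approximate diagonalization over \<open>C(M)\<close>\<close>

text \<open>The elements of \<open>C(M)\<close> are represented by functions on the whole type; only their
  values on \<open>topspace M\<close> matter, and nothing below depends on other values. The algebraic
  operations of \<open>M\<^sub>n(C(M))\<close> are pointwise in the points of \<open>M\<close>, so that they are
  expressed by evaluating matrices over \<open>C(M)\<close> at the points of \<open>M\<close>.\<close>

definition cfun_alg :: "'a topology \<Rightarrow> ('a \<Rightarrow> complex) set" where
  "cfun_alg M = {f. continuous_map M euclidean f}"

definition cfun_mats :: "'a topology \<Rightarrow> nat \<Rightarrow> ('a \<Rightarrow> complex) mat set" where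
  "cfun_mats M n = {A \<in> carrier_mat n n. \<forall>i<n. \<forall>j<n. A $$ (i, j) \<in> cfun_alg M}"

definition eval_mat :: "('a \<Rightarrow> complex) mat \<Rightarrow> 'a \<Rightarrow> complex mat" where
  "eval_mat A x = map_mat (\<lambda>f. f x) A"

definition self_adjoint_on :: "'a topology \<Rightarrow> ('a \<Rightarrow> complex) mat \<Rightarrow> bool" where
  "self_adjoint_on M A \<longleftrightarrow> (\<forall>x\<in>topspace M. mat_adjoint (eval_mat A x) = eval_mat A x)"

definition cfun_unitaries :: "'a topology \<Rightarrow> nat \<Rightarrow> ('a \<Rightarrow> complex) mat set" where
  "cfun_unitaries M n =
    {U \<in> cfun_mats M n. \<forall>x\<in>topspace M.
       eval_mat U x * mat_adjoint (eval_mat U x) = 1\<^sub>m n \<and>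
       mat_adjoint (eval_mat U x) * eval_mat U x = 1\<^sub>m n}"

definition l2_norm_vec :: "complex vec \<Rightarrow> real" where
  "l2_norm_vec v = sqrt (\<Sum>i<dim_vec v. (cmod (vec_index v i))\<^sup>2)"

definition op_norm_mat :: "complex mat \<Rightarrow> real" where
  "op_norm_mat A =
    Sup {l2_norm_vec (A *\<^sub>v v) | v. v \<in> carrier_vec (dim_col A) \<and> l2_norm_vec v \<le> 1}"

text \<open>The \<open>C\<^sup>*\<close>-norm of \<open>M\<^sub>n(C(M)) = C(M, M\<^sub>n(\<complex>))\<close>: the supremum over \<open>M\<close> of the operator norm.
  Inserting 0 changes nothing unless \<open>M\<close> is empty, where it makes the norm 0.\<close>

definition sup_op_norm :: "'a topology \<Rightarrow> ('a \<Rightarrow> complex mat) \<Rightarrow> real" where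
  "sup_op_norm M F = Sup (insert 0 ((\<lambda>x. op_norm_mat (F x)) ` topspace M))"

definition approx_diagonalizable :: "'a topology \<Rightarrow> nat \<Rightarrow> ('a \<Rightarrow> complex) mat \<Rightarrow> bool" where
  "approx_diagonalizable M n A \<longleftrightarrow>
    (\<forall>\<epsilon>>0. \<exists>U\<in>cfun_unitaries M n. \<exists>a. (\<forall>i<n. a i \<in> cfun_alg M) \<and>
       sup_op_norm M (\<lambda>x. eval_mat U x * eval_mat A x * mat_adjoint (eval_mat U x)
                          - mat_diag n (\<lambda>i. a i x)) < \<epsilon>)"

definition approx_diagonal :: "'a topology \<Rightarrow> bool" where
  "approx_diagonal M \<longleftrightarrow>
    (\<forall>n\<ge>2. \<forall>A\<in>cfun_mats M n. self_adjoint_on M A \<longrightarrow> approx_diagonalizable M n A)"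


section \<open>Covering dimension\<close>

definition open_cover :: "'a topology \<Rightarrow> 'a set set \<Rightarrow> bool" where
  "open_cover X \<U> \<longleftrightarrow> (\<forall>U\<in>\<U>. openin X U) \<and> \<Union>\<U> = topspace X"

text \<open>\<open>dim X \<le> n\<close>: every finite open cover has a finite open refinement of order at most \<open>n\<close>,
  that is, with no point lying in more than \<open>n + 1\<close> members.\<close>

definition covering_dim_le :: "'a topology \<Rightarrow> nat \<Rightarrow> bool" where
  "covering_dim_le X n \<longleftrightarrow>
    (\<forall>\<U>. finite \<U> \<and> open_cover X \<U> \<longrightarrow>
      (\<exists>\<V>. finite \<V> \<and> open_cover X \<V> \<and> (\<forall>V\<in>\<V>. \<exists>U\<in>\<U>. V \<subseteq> U) \<and>
            (\<forall>x\<in>topspace X. card {V\<in>\<V>. x \<in> V} \<le> n + 1)))"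


section \<open>Integral Cech cohomology\<close>

text \<open>The direct limit, over all open covers ordered by refinement, of the integral simplicial
  cohomology of the nerves. The cohomology of a nerve is computed from its ordered cochains
  (functions on all tuples of members with a common point, repetitions allowed), extended by
  zero to all other lists.\<close>

definition nerve_simplices :: "'a set set \<Rightarrow> nat \<Rightarrow> 'a set list set" where
  "nerve_simplices \<U> n = {s. length s = Suc n \<and> set s \<subseteq> \<U> \<and> \<Inter>(set s) \<noteq> {}}"

definition nerve_cochains :: "'a set set \<Rightarrow> nat \<Rightarrow> ('a set list \<Rightarrow> int) set" where
  "nerve_cochains \<U> n = {c. \<forall>s. s \<notin> nerve_simplices \<U> n \<longrightarrow> c s = 0}"

definition nerve_coboundary ::
    "'a set set \<Rightarrow> nat \<Rightarrow> ('a set list \<Rightarrow> int) \<Rightarrow> 'a set list \<Rightarrow> int" where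
  "nerve_coboundary \<U> n c s =
    (if s \<in> nerve_simplices \<U> (Suc n)
     then \<Sum>i\<le>Suc n. (-1) ^ i * c (take i s @ drop (Suc i) s) else 0)"

definition nerve_cocycles :: "'a set set \<Rightarrow> nat \<Rightarrow> ('a set list \<Rightarrow> int) set" where
  "nerve_cocycles \<U> n = {c \<in> nerve_cochains \<U> n. nerve_coboundary \<U> n c = (\<lambda>_. 0)}"

definition nerve_coboundaries :: "'a set set \<Rightarrow> nat \<Rightarrow> ('a set list \<Rightarrow> int) set" where
  "nerve_coboundaries \<U> n =
    (case n of 0 \<Rightarrow> {\<lambda>_. 0} | Suc m \<Rightarrow> nerve_coboundary \<U> m ` nerve_cochains \<U> m)"

definition refinement_map :: "'a set set \<Rightarrow> 'a set set \<Rightarrow> ('a set \<Rightarrow> 'a set) \<Rightarrow> bool" where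
  "refinement_map \<W> \<U> p \<longleftrightarrow> (\<forall>W\<in>\<W>. p W \<in> \<U> \<and> W \<subseteq> p W)"

definition nerve_pullback ::
    "'a set set \<Rightarrow> nat \<Rightarrow> ('a set \<Rightarrow> 'a set) \<Rightarrow> ('a set list \<Rightarrow> int) \<Rightarrow> 'a set list \<Rightarrow> int" where
  "nerve_pullback \<W> n p c s = (if s \<in> nerve_simplices \<W> n then c (map p s) else 0)"

definition cech_cocycles :: "'a topology \<Rightarrow> nat \<Rightarrow> ('a set set \<times> ('a set list \<Rightarrow> int)) set" where
  "cech_cocycles X n = (SIGMA \<U> : Collect (open_cover X). nerve_cocycles \<U> n)"

text \<open>Two cocycles on nerves represent the same element of the direct limit if their pullbacks
  to some common refinement are cohomologous.\<close>

definition cech_rel :: "'a topology \<Rightarrow> nat \<Rightarrow>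
    (('a set set \<times> ('a set list \<Rightarrow> int)) \<times> ('a set set \<times> ('a set list \<Rightarrow> int))) set" where
  "cech_rel X n = {((\<U>, c), (\<V>, d)).
     (\<U>, c) \<in> cech_cocycles X n \<and> (\<V>, d) \<in> cech_cocycles X n \<and>
     (\<exists>\<W> p q. open_cover X \<W> \<and> refinement_map \<W> \<U> p \<and> refinement_map \<W> \<V> q \<and>
        (\<lambda>s. nerve_pullback \<W> n p c s - nerve_pullback \<W> n q d s) \<in> nerve_coboundaries \<W> n)}"

text \<open>The sum of two classes is formed by pulling representatives back to a common refinement;
  it is well defined by \<open>cech_mult_class\<close> below.\<close>

definition cech_cohomology ::
    "'a topology \<Rightarrow> nat \<Rightarrow> ('a set set \<times> ('a set list \<Rightarrow> int)) set monoid" where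
  "cech_cohomology X n =
    \<lparr>carrier = cech_cocycles X n // cech_rel X n,
     monoid.mult = (\<lambda>A B. \<Union>{cech_rel X n `` {(\<W>, \<lambda>s. nerve_pullback \<W> n p c s + nerve_pullback \<W> n q d s)}
               | \<U> c \<V> d \<W> p q. (\<U>, c) \<in> A \<and> (\<V>, d) \<in> B \<and> open_cover X \<W> \<and>
                   refinement_map \<W> \<U> p \<and> refinement_map \<W> \<V> q}),
     monoid.one = cech_rel X n `` {({topspace X}, \<lambda>_. 0)}\<rparr>"


subsection \<open>It is an abelian group\<close>

fun dlt :: "('b list \<Rightarrow> int) \<Rightarrow> 'b list \<Rightarrow> int" where
  "dlt c [] = 0"
| "dlt c (x # s) = c s - dlt (\<lambda>t. c (x # t)) s"

lemma dlt_sum: "dlt c s = (\<Sum>i<length s. (-1) ^ i * c (take i s @ drop (Suc i) s))"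
proof (induction s arbitrary: c)
  case (Cons x s)
  show ?case
    unfolding dlt.simps Cons.IH length_Cons sum.lessThan_Suc_shift
    by (simp add: sum_negf)
qed simp

lemma nerve_coboundary_dlt:
  "nerve_coboundary \<U> n c s = (if s \<in> nerve_simplices \<U> (Suc n) then dlt c s else 0)"
proof (cases "s \<in> nerve_simplices \<U> (Suc n)")
  case True
  then have "{..<length s} = {..Suc n}"
    by (simp only: nerve_simplices_def mem_Collect_eq lessThan_Suc_atMost)
  then show ?thesis
    using True by (simp only: nerve_coboundary_def dlt_sum if_True)
qed (simp add: nerve_coboundary_def)

lemma dlt_cong:
  assumes "\<And>t. Suc (length t) = length s \<Longrightarrow> set t \<subseteq> set s \<Longrightarrow> c t = d t"
  shows "dlt c s = dlt d s"
  unfolding dlt_sum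
proof (rule sum.cong)
  fix i assume i: "i \<in> {..<length s}"
  have "set (take i s @ drop (Suc i) s) \<subseteq> set s"
    by (auto dest: in_set_takeD in_set_dropD)
  then show "(-1) ^ i * c (take i s @ drop (Suc i) s) = (-1) ^ i * d (take i s @ drop (Suc i) s)"
    using i assms[of "take i s @ drop (Suc i) s"] by auto
qed simp

lemma dlt_zero [simp]: "dlt (\<lambda>_. 0) s = 0"
  by (simp add: dlt_sum)

lemma dlt_add: "dlt (\<lambda>t. c t + d t) s = dlt c s + dlt d s"
  by (simp add: dlt_sum distrib_left sum.distrib)

lemma dlt_diff: "dlt (\<lambda>t. c t - d t) s = dlt c s - dlt d s"
  by (simp add: dlt_sum right_diff_distrib sum_subtractf)

lemma dlt_uminus: "dlt (\<lambda>t. - c t) s = - dlt c s"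
  by (simp add: dlt_sum sum_negf)

lemma dlt_map: "dlt c (map p s) = dlt (\<lambda>t. c (map p t)) s"
  by (induction s arbitrary: c) auto

lemma dlt_dlt: "dlt (dlt c) s = 0"
  by (induction s arbitrary: c) (simp_all add: dlt_diff)

text \<open>The prism operator, a homotopy between the pullbacks along two refinement maps.\<close>

fun prism :: "('b \<Rightarrow> 'c) \<Rightarrow> ('b \<Rightarrow> 'c) \<Rightarrow> ('c list \<Rightarrow> int) \<Rightarrow> 'b list \<Rightarrow> int" where
  "prism p q c [] = 0"
| "prism p q c (x # s) = c (p x # q x # map q s) - prism p q (\<lambda>t. c (p x # t)) s"

lemma prism_diff: "prism p q (\<lambda>t. c t - d t) s = prism p q c s - prism p q d s"
  by (induction s arbitrary: c d) auto

lemma prism_eq_0: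
  assumes "\<And>t. length t = Suc (length s) \<Longrightarrow> set t \<subseteq> p ` set s \<union> q ` set s \<Longrightarrow> c t = 0"
  shows "prism p q c s = 0"
  using assms
proof (induction s arbitrary: c)
  case (Cons x s)
  have "prism p q (\<lambda>t. c (p x # t)) s = 0"
    by (rule Cons.IH, rule Cons.prems) auto
  moreover have "c (p x # q x # map q s) = 0"
    by (rule Cons.prems) auto
  ultimately show ?case by simp
qed simp

lemma prism_homotopy:
  "dlt (prism p q c) s + prism p q (dlt c) s = c (map q s) - c (map p s)"
proof (induction s arbitrary: c)
  case (Cons x s)
  let ?c = "\<lambda>t. c (p x # t)"
  have "prism p q (dlt c) (x # s) =
      c (q x # map q s) - (?c (map q s) - dlt (\<lambda>t. c (p x # q x # t)) (map q s))
      - (prism p q c s - prism p q (dlt ?c) s)"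
    by (simp add: prism_diff)
  moreover have "dlt (prism p q c) (x # s) =
      prism p q c s - (dlt (\<lambda>t. c (p x # q x # t)) (map q s) - dlt (prism p q ?c) s)"
    by (simp add: dlt_diff dlt_map)
  ultimately show ?case using Cons.IH[of ?c] by simp
qed simp

lemma nerve_simplices_map:
  assumes "refinement_map \<W> \<U> p" "s \<in> nerve_simplices \<W> n"
  shows "map p s \<in> nerve_simplices \<U> n"
proof -
  obtain x where "\<forall>W\<in>set s. x \<in> W" using assms(2) by (auto simp: nerve_simplices_def)
  then have "x \<in> \<Inter>(set (map p s))"
    using assms by (fastforce simp: nerve_simplices_def refinement_map_def)
  then show ?thesis
    using assms by (auto simp: nerve_simplices_def refinement_map_def)
qed

lemma nerve_simplices_face:
  assumes "s \<in> nerve_simplices \<U> m" "set t \<subseteq> set s" "length t = Suc n"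
  shows "t \<in> nerve_simplices \<U> n"
  using assms by (fastforce simp: nerve_simplices_def)

lemma nerve_cocycles_iff:
  "c \<in> nerve_cocycles \<U> n \<longleftrightarrow>
    (\<forall>s. s \<notin> nerve_simplices \<U> n \<longrightarrow> c s = 0) \<and> (\<forall>s\<in>nerve_simplices \<U> (Suc n). dlt c s = 0)"
  by (auto simp: nerve_cocycles_def nerve_cochains_def nerve_coboundary_dlt fun_eq_iff)

lemma zero_cocycle: "(\<lambda>_. 0) \<in> nerve_cocycles \<U> n"
  by (simp add: nerve_cocycles_iff)

lemma add_cocycle:
  "c \<in> nerve_cocycles \<U> n \<Longrightarrow> d \<in> nerve_cocycles \<U> n \<Longrightarrow> (\<lambda>s. c s + d s) \<in> nerve_cocycles \<U> n"
  by (simp add: nerve_cocycles_iff dlt_add)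

lemma uminus_cocycle: "c \<in> nerve_cocycles \<U> n \<Longrightarrow> (\<lambda>s. - c s) \<in> nerve_cocycles \<U> n"
  by (simp add: nerve_cocycles_iff dlt_uminus)

lemma pullback_cocycle:
  assumes r: "refinement_map \<W> \<U> p" and c: "c \<in> nerve_cocycles \<U> n"
  shows "nerve_pullback \<W> n p c \<in> nerve_cocycles \<W> n"
  unfolding nerve_cocycles_iff
proof (intro conjI ballI allI impI)
  fix s assume s: "s \<in> nerve_simplices \<W> (Suc n)"
  have "dlt (nerve_pullback \<W> n p c) s = dlt (\<lambda>t. c (map p t)) s"
    using s nerve_simplices_face[OF s]
    by (intro dlt_cong) (auto simp: nerve_pullback_def nerve_simplices_def[of _ "Suc n"])
  also have "\<dots> = 0"
    using nerve_simplices_map[OF r s] c by (simp add: dlt_map[symmetric] nerve_cocycles_iff)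
  finally show "dlt (nerve_pullback \<W> n p c) s = 0" .
qed (simp add: nerve_pullback_def)

lemma coboundariesI:
  assumes "b \<in> nerve_cochains \<U> m" "n = Suc m"
    "\<And>s. c s = (if s \<in> nerve_simplices \<U> n then dlt b s else 0)"
  shows "c \<in> nerve_coboundaries \<U> n"
proof -
  have "c = nerve_coboundary \<U> m b"
    using assms by (simp add: fun_eq_iff nerve_coboundary_dlt)
  then show ?thesis using assms by (simp add: nerve_coboundaries_def)
qed

lemma coboundariesE:
  assumes "c \<in> nerve_coboundaries \<U> n"
  obtains "n = 0" "c = (\<lambda>_. 0)"
  | m b where "n = Suc m" "b \<in> nerve_cochains \<U> m"
      "\<And>s. c s = (if s \<in> nerve_simplices \<U> n then dlt b s else 0)"
  using assms that
  by (cases n) (auto simp: nerve_coboundaries_def nerve_coboundary_dlt image_iff)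

lemma coboundary_cocycle:
  assumes "c \<in> nerve_coboundaries \<U> n"
  shows "c \<in> nerve_cocycles \<U> n"
  using assms
proof (cases rule: coboundariesE)
  case 1
  show ?thesis unfolding 1(2) by (rule zero_cocycle)
next
  case (2 m b)
  have "dlt c s = 0" if s: "s \<in> nerve_simplices \<U> (Suc n)" for s
  proof -
    have "dlt c s = dlt (dlt b) s"
    proof (rule dlt_cong)
      fix t assume t: "Suc (length t) = length s" "set t \<subseteq> set s"
      have "length t = Suc n" using s t(1) by (simp add: nerve_simplices_def)
      then have "t \<in> nerve_simplices \<U> n" by (rule nerve_simplices_face[OF s t(2)])
      then show "c t = dlt b t" by (simp add: 2(3))
    qed
    then show ?thesis by (simp only: dlt_dlt)
  qed
  then show ?thesis by (simp add: nerve_cocycles_iff 2(3))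
qed

lemma zero_coboundary: "(\<lambda>_. 0) \<in> nerve_coboundaries \<U> n"
proof (cases n)
  case (Suc m)
  show ?thesis
    by (rule coboundariesI[where b = "\<lambda>_. 0", OF _ Suc]) (auto simp: nerve_cochains_def)
qed (simp add: nerve_coboundaries_def)

lemma add_coboundary:
  assumes "c \<in> nerve_coboundaries \<U> n" "d \<in> nerve_coboundaries \<U> n"
  shows "(\<lambda>s. c s + d s) \<in> nerve_coboundaries \<U> n"
  using assms(1)
proof (cases rule: coboundariesE)
  case 1
  then show ?thesis using assms(2) by simp
next
  case (2 m b)
  from assms(2) show ?thesis
  proof (cases rule: coboundariesE)
    case (2 m' b')
    show ?thesis
      by (rule coboundariesI[where b = "\<lambda>s. b s + b' s" and m = m])
        (use 2 \<open>n = Suc m\<close> \<open>b \<in> _\<close> \<open>\<And>s. c s = _\<close> in \<open>auto simp: nerve_cochains_def dlt_add\<close>)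
  qed (use 2 in simp)
qed

lemma uminus_coboundary:
  assumes "c \<in> nerve_coboundaries \<U> n"
  shows "(\<lambda>s. - c s) \<in> nerve_coboundaries \<U> n"
  using assms
proof (cases rule: coboundariesE)
  case 1
  then show ?thesis by (simp add: nerve_coboundaries_def)
next
  case (2 m b)
  show ?thesis
    by (rule coboundariesI[where b = "\<lambda>s. - b s" and m = m])
      (use 2 in \<open>auto simp: nerve_cochains_def dlt_uminus\<close>)
qed

lemma pullback_coboundary:
  assumes r: "refinement_map \<W> \<U> p" and c: "c \<in> nerve_coboundaries \<U> n"
  shows "nerve_pullback \<W> n p c \<in> nerve_coboundaries \<W> n"
  using c
proof (cases rule: coboundariesE)
  case 1
  then show ?thesis using zero_coboundary[of \<W> n] by (simp add: nerve_pullback_def[abs_def])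
next
  case (2 m b)
  show ?thesis
  proof (rule coboundariesI[where b = "nerve_pullback \<W> m p b" and m = m])
    fix s
    show "nerve_pullback \<W> n p c s =
        (if s \<in> nerve_simplices \<W> n then dlt (nerve_pullback \<W> m p b) s else 0)"
    proof (cases "s \<in> nerve_simplices \<W> n")
      case True
      have "dlt (nerve_pullback \<W> m p b) s = dlt (\<lambda>t. b (map p t)) s"
        using True nerve_simplices_face[OF True] 2(1)
        by (intro dlt_cong) (auto simp: nerve_pullback_def nerve_simplices_def[of _ "Suc m"])
      then show ?thesis
        using True nerve_simplices_map[OF r True] 2(3) by (simp add: nerve_pullback_def dlt_map)
    qed (simp add: nerve_pullback_def)
  qed (use 2 in \<open>auto simp: nerve_cochains_def nerve_pullback_def\<close>)
qed

lemma pullback_comp: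
  "refinement_map \<V> \<W> r \<Longrightarrow>
    nerve_pullback \<V> n r (nerve_pullback \<W> n p c) = nerve_pullback \<V> n (p \<circ> r) c"
  by (auto simp: nerve_pullback_def nerve_simplices_map fun_eq_iff)

lemma pullback_id: "c \<in> nerve_cocycles \<U> n \<Longrightarrow> nerve_pullback \<U> n id c = c"
  by (auto simp: nerve_pullback_def nerve_cocycles_iff fun_eq_iff)

lemma refinement_comp:
  "refinement_map \<V> \<W> r \<Longrightarrow> refinement_map \<W> \<U> p \<Longrightarrow> refinement_map \<V> \<U> (p \<circ> r)"
  by (fastforce simp: refinement_map_def)

lemma refinement_id: "refinement_map \<U> \<U> id"
  by (simp add: refinement_map_def)

lemma pullback_indep:
  assumes p: "refinement_map \<W> \<U> p" and q: "refinement_map \<W> \<U> q"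
    and c: "c \<in> nerve_cocycles \<U> n"
  shows "(\<lambda>s. nerve_pullback \<W> n q c s - nerve_pullback \<W> n p c s) \<in> nerve_coboundaries \<W> n"
proof -
  have *: "c (map q s) - c (map p s) = dlt (prism p q c) s" if s: "s \<in> nerve_simplices \<W> n" for s
  proof -
    have "prism p q (dlt c) s = 0"
    proof (rule prism_eq_0)
      fix t assume t: "length t = Suc (length s)" "set t \<subseteq> p ` set s \<union> q ` set s"
      obtain x where x: "\<forall>W\<in>set s. x \<in> W" using s by (auto simp: nerve_simplices_def)
      have sW: "set s \<subseteq> \<W>" and ls: "length s = Suc n"
        using s by (simp_all add: nerve_simplices_def)
      have V: "x \<in> V \<and> V \<in> \<U>" if "V \<in> set t" for V
      proof -
        from that t(2) obtain W where W: "W \<in> set s" "V = p W \<or> V = q W" by blast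
        then have "x \<in> W" "W \<in> \<W>" using x sW by auto
        then show ?thesis using W(2) p q unfolding refinement_map_def by blast
      qed
      then have "x \<in> \<Inter>(set t)" "set t \<subseteq> \<U>" by auto
      then have "t \<in> nerve_simplices \<U> (Suc n)"
        using t(1) ls by (auto simp only: nerve_simplices_def mem_Collect_eq)
      then show "dlt c t = 0" using c by (simp add: nerve_cocycles_iff)
    qed
    then show ?thesis using prism_homotopy[of p q c s] by simp
  qed
  show ?thesis
  proof (cases n)
    case 0
    have "c (map q s) - c (map p s) = 0" if "s \<in> nerve_simplices \<W> n" for s
    proof -
      have "length s = Suc 0" using that 0 by (simp add: nerve_simplices_def)
      then obtain y where "s = [y]" by (metis length_0_conv length_Suc_conv)
      with * [OF that] show ?thesis by simp
    qed
    then have "(\<lambda>s. nerve_pullback \<W> n q c s - nerve_pullback \<W> n p c s) = (\<lambda>_. 0)"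
      by (intro ext) (simp add: nerve_pullback_def)
    then show ?thesis by (simp only: zero_coboundary)
  next
    case (Suc m)
    show ?thesis
    proof (rule coboundariesI[where b = "\<lambda>t. if t \<in> nerve_simplices \<W> m then prism p q c t else 0",
          OF _ Suc])
      fix s
      show "nerve_pullback \<W> n q c s - nerve_pullback \<W> n p c s =
        (if s \<in> nerve_simplices \<W> n
         then dlt (\<lambda>t. if t \<in> nerve_simplices \<W> m then prism p q c t else 0) s else 0)"
      proof (cases "s \<in> nerve_simplices \<W> n")
        case True
        have "dlt (\<lambda>t. if t \<in> nerve_simplices \<W> m then prism p q c t else 0) s =
            dlt (prism p q c) s"
          using True nerve_simplices_face[OF True] Suc
          by (intro dlt_cong) (auto simp: nerve_simplices_def[of _ "Suc m"])
        then show ?thesis using True * by (simp add: nerve_pullback_def)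
      qed (simp add: nerve_pullback_def)
    qed (simp add: nerve_cochains_def)
  qed
qed

lemma common_refinement:
  assumes "open_cover X \<U>" "open_cover X \<V>"
  obtains \<W> p q where "open_cover X \<W>" "refinement_map \<W> \<U> p" "refinement_map \<W> \<V> q"
proof -
  define \<W> where "\<W> = {U \<inter> V | U V. U \<in> \<U> \<and> V \<in> \<V>}"
  have "\<Union>\<W> = \<Union>\<U> \<inter> \<Union>\<V>" by (auto simp: \<W>_def)
  then have "open_cover X \<W>" using assms by (auto simp: open_cover_def \<W>_def)
  moreover have "\<forall>W\<in>\<W>. \<exists>U. U \<in> \<U> \<and> W \<subseteq> U" "\<forall>W\<in>\<W>. \<exists>V. V \<in> \<V> \<and> W \<subseteq> V"
    by (auto simp: \<W>_def)
  then obtain p q where "refinement_map \<W> \<U> p" "refinement_map \<W> \<V> q"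
    unfolding refinement_map_def by metis
  ultimately show ?thesis by (rule that)
qed

lemma cech_cocycles_iff:
  "(\<U>, c) \<in> cech_cocycles X n \<longleftrightarrow> open_cover X \<U> \<and> c \<in> nerve_cocycles \<U> n"
  by (simp add: cech_cocycles_def)

lemma cech_relE:
  assumes "((\<U>, c), (\<V>, d)) \<in> cech_rel X n"
  obtains \<W> where "open_cover X \<W>" "\<exists>r. refinement_map \<W> \<U> r" "\<exists>r. refinement_map \<W> \<V> r"
    "\<And>\<Y> r p q. refinement_map \<Y> \<W> r \<Longrightarrow> refinement_map \<Y> \<U> p \<Longrightarrow> refinement_map \<Y> \<V> q \<Longrightarrow>
      (\<lambda>s. nerve_pullback \<Y> n p c s - nerve_pullback \<Y> n q d s) \<in> nerve_coboundaries \<Y> n"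
proof -
  from assms obtain \<W> p q where c: "c \<in> nerve_cocycles \<U> n" and d: "d \<in> nerve_cocycles \<V> n"
    and W: "open_cover X \<W>" and p: "refinement_map \<W> \<U> p" and q: "refinement_map \<W> \<V> q"
    and b: "(\<lambda>s. nerve_pullback \<W> n p c s - nerve_pullback \<W> n q d s) \<in> nerve_coboundaries \<W> n"
    by (auto simp: cech_rel_def cech_cocycles_iff)
  show ?thesis
  proof (rule that[OF W])
    fix \<Y> r p' q'
    assume r: "refinement_map \<Y> \<W> r" and p': "refinement_map \<Y> \<U> p'"
      and q': "refinement_map \<Y> \<V> q'"
    have 1: "(\<lambda>s. nerve_pullback \<Y> n p' c s - nerve_pullback \<Y> n (p \<circ> r) c s)
        \<in> nerve_coboundaries \<Y> n"
      by (rule pullback_indep[OF refinement_comp[OF r p] p' c])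
    have 2: "(\<lambda>s. nerve_pullback \<Y> n (q \<circ> r) d s - nerve_pullback \<Y> n q' d s)
        \<in> nerve_coboundaries \<Y> n"
      by (rule pullback_indep[OF q' refinement_comp[OF r q] d])
    have "nerve_pullback \<Y> n r (\<lambda>s. nerve_pullback \<W> n p c s - nerve_pullback \<W> n q d s) =
        (\<lambda>s. nerve_pullback \<Y> n (p \<circ> r) c s - nerve_pullback \<Y> n (q \<circ> r) d s)"
      unfolding pullback_comp[OF r, symmetric] by (auto simp: nerve_pullback_def fun_eq_iff)
    then have 3: "(\<lambda>s. nerve_pullback \<Y> n (p \<circ> r) c s - nerve_pullback \<Y> n (q \<circ> r) d s)
        \<in> nerve_coboundaries \<Y> n"
      using pullback_coboundary[OF r b] by simp
    show "(\<lambda>s. nerve_pullback \<Y> n p' c s - nerve_pullback \<Y> n q' d s) \<in> nerve_coboundaries \<Y> n"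
      using add_coboundary[OF add_coboundary[OF 1 3] 2] by simp
  qed (use p q in auto)
qed

lemma cech_relI:
  assumes "(\<U>, c) \<in> cech_cocycles X n" "(\<V>, d) \<in> cech_cocycles X n"
    "open_cover X \<W>" "refinement_map \<W> \<U> p" "refinement_map \<W> \<V> q"
    "(\<lambda>s. nerve_pullback \<W> n p c s - nerve_pullback \<W> n q d s) \<in> nerve_coboundaries \<W> n"
  shows "((\<U>, c), (\<V>, d)) \<in> cech_rel X n"
  using assms by (auto simp: cech_rel_def)

lemma equiv_cech_rel: "equiv (cech_cocycles X n) (cech_rel X n)"
proof (rule equivI)
  show "cech_rel X n \<subseteq> cech_cocycles X n \<times> cech_cocycles X n"
    by (auto simp: cech_rel_def)
  show "refl_on (cech_cocycles X n) (cech_rel X n)"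
  proof (rule refl_onI)
    fix x assume x: "x \<in> cech_cocycles X n"
    obtain \<U> c where eq: "x = (\<U>, c)" by (cases x)
    have U: "open_cover X \<U>" using x by (simp add: eq cech_cocycles_iff)
    show "(x, x) \<in> cech_rel X n"
      unfolding eq
      by (rule cech_relI[OF x[unfolded eq] x[unfolded eq] U refinement_id refinement_id])
        (simp only: diff_self zero_coboundary)
  qed
  show "sym (cech_rel X n)"
  proof (rule symI)
    fix x y assume xy: "(x, y) \<in> cech_rel X n"
    obtain \<U> c \<V> d where eq: "x = (\<U>, c)" "y = (\<V>, d)" by (metis surj_pair)
    from xy[unfolded eq] obtain \<W> p q where c: "(\<U>, c) \<in> cech_cocycles X n"
      and d: "(\<V>, d) \<in> cech_cocycles X n" and W: "open_cover X \<W>"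
      and p: "refinement_map \<W> \<U> p" and q: "refinement_map \<W> \<V> q"
      and b: "(\<lambda>s. nerve_pullback \<W> n p c s - nerve_pullback \<W> n q d s) \<in> nerve_coboundaries \<W> n"
      by (auto simp: cech_rel_def)
    show "(y, x) \<in> cech_rel X n"
      unfolding eq
      by (rule cech_relI[OF d c W q p]) (use uminus_coboundary[OF b] in simp)
  qed
  show "trans (cech_rel X n)"
  proof (rule transI)
    fix x y z assume xy: "(x, y) \<in> cech_rel X n" and yz: "(y, z) \<in> cech_rel X n"
    obtain \<U> c \<V> d \<Y> e where eq: "x = (\<U>, c)" "y = (\<V>, d)" "z = (\<Y>, e)"
      by (metis surj_pair)
    from xy[unfolded eq] obtain \<W>1 p1 q1 where 1: "open_cover X \<W>1" "refinement_map \<W>1 \<U> p1"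
      "refinement_map \<W>1 \<V> q1"
      "\<And>\<Y> r p q. refinement_map \<Y> \<W>1 r \<Longrightarrow> refinement_map \<Y> \<U> p \<Longrightarrow> refinement_map \<Y> \<V> q \<Longrightarrow>
      (\<lambda>s. nerve_pullback \<Y> n p c s - nerve_pullback \<Y> n q d s) \<in> nerve_coboundaries \<Y> n"
      by (elim cech_relE) blast
    from yz[unfolded eq] obtain \<W>2 p2 q2 where 2: "open_cover X \<W>2" "refinement_map \<W>2 \<V> p2"
      "refinement_map \<W>2 \<Y> q2"
      "\<And>\<Z> r p q. refinement_map \<Z> \<W>2 r \<Longrightarrow> refinement_map \<Z> \<V> p \<Longrightarrow> refinement_map \<Z> \<Y> q \<Longrightarrow>
      (\<lambda>s. nerve_pullback \<Z> n p d s - nerve_pullback \<Z> n q e s) \<in> nerve_coboundaries \<Z> n"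
      by (elim cech_relE) blast
    obtain \<W> r1 r2 where W: "open_cover X \<W>" "refinement_map \<W> \<W>1 r1" "refinement_map \<W> \<W>2 r2"
      using common_refinement[OF 1(1) 2(1)] by blast
    have U: "refinement_map \<W> \<U> (p1 \<circ> r1)" and V: "refinement_map \<W> \<V> (q1 \<circ> r1)"
      and Y: "refinement_map \<W> \<Y> (q2 \<circ> r2)"
      using W 1 2 by (auto intro: refinement_comp)
    have xz: "(\<U>, c) \<in> cech_cocycles X n" "(\<Y>, e) \<in> cech_cocycles X n"
      using xy yz by (simp_all add: eq cech_rel_def)
    show "(x, z) \<in> cech_rel X n"
      unfolding eq
    proof (rule cech_relI[OF xz W(1) U Y])
      show "(\<lambda>s. nerve_pullback \<W> n (p1 \<circ> r1) c s - nerve_pullback \<W> n (q2 \<circ> r2) e s)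
          \<in> nerve_coboundaries \<W> n"
        using add_coboundary[OF 1(4)[OF W(2) U V] 2(4)[OF W(3) V Y]] by simp
    qed
  qed
qed

lemma cech_rel_add:
  assumes "((\<U>, c), (\<V>, d)) \<in> cech_rel X n" "((\<U>, c'), (\<V>, d')) \<in> cech_rel X n"
  shows "((\<U>, \<lambda>s. c s + c' s), (\<V>, \<lambda>s. d s + d' s)) \<in> cech_rel X n"
proof -
  from assms(1) obtain \<W>1 p1 q1 where 1: "open_cover X \<W>1" "refinement_map \<W>1 \<U> p1"
    "refinement_map \<W>1 \<V> q1"
    "\<And>\<Y> r p q. refinement_map \<Y> \<W>1 r \<Longrightarrow> refinement_map \<Y> \<U> p \<Longrightarrow> refinement_map \<Y> \<V> q \<Longrightarrow>
    (\<lambda>s. nerve_pullback \<Y> n p c s - nerve_pullback \<Y> n q d s) \<in> nerve_coboundaries \<Y> n"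
    by (elim cech_relE) blast
  from assms(2) obtain \<W>2 where 2: "open_cover X \<W>2"
    "\<And>\<Z> r p q. refinement_map \<Z> \<W>2 r \<Longrightarrow> refinement_map \<Z> \<U> p \<Longrightarrow> refinement_map \<Z> \<V> q \<Longrightarrow>
    (\<lambda>s. nerve_pullback \<Z> n p c' s - nerve_pullback \<Z> n q d' s) \<in> nerve_coboundaries \<Z> n"
    by (elim cech_relE) blast
  obtain \<W> r1 r2 where W: "open_cover X \<W>" "refinement_map \<W> \<W>1 r1" "refinement_map \<W> \<W>2 r2"
    using common_refinement[OF 1(1) 2(1)] by blast
  have U: "refinement_map \<W> \<U> (p1 \<circ> r1)" and V: "refinement_map \<W> \<V> (q1 \<circ> r1)"
    using W 1 by (auto intro: refinement_comp)
  have eq: "(\<lambda>s. nerve_pullback \<W> n (p1 \<circ> r1) (\<lambda>s. c s + c' s) s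
          - nerve_pullback \<W> n (q1 \<circ> r1) (\<lambda>s. d s + d' s) s) =
      (\<lambda>s. (nerve_pullback \<W> n (p1 \<circ> r1) c s - nerve_pullback \<W> n (q1 \<circ> r1) d s) +
           (nerve_pullback \<W> n (p1 \<circ> r1) c' s - nerve_pullback \<W> n (q1 \<circ> r1) d' s))"
    by (auto simp: nerve_pullback_def fun_eq_iff)
  show ?thesis
  proof (rule cech_relI[OF _ _ W(1) U V])
    show "(\<lambda>s. nerve_pullback \<W> n (p1 \<circ> r1) (\<lambda>s. c s + c' s) s
          - nerve_pullback \<W> n (q1 \<circ> r1) (\<lambda>s. d s + d' s) s) \<in> nerve_coboundaries \<W> n"
      unfolding eq by (rule add_coboundary[OF 1(4)[OF W(2) U V] 2(2)[OF W(3) U V]])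
    have "(\<U>, c) \<in> cech_cocycles X n" "(\<U>, c') \<in> cech_cocycles X n"
      "(\<V>, d) \<in> cech_cocycles X n" "(\<V>, d') \<in> cech_cocycles X n"
      using assms by (simp_all add: cech_rel_def)
    then show "(\<U>, \<lambda>s. c s + c' s) \<in> cech_cocycles X n" "(\<V>, \<lambda>s. d s + d' s) \<in> cech_cocycles X n"
      unfolding cech_cocycles_iff by (blast intro: add_cocycle)+
  qed
qed

lemma cech_rel_pullback:
  assumes "(\<U>, c) \<in> cech_cocycles X n" "open_cover X \<W>" "refinement_map \<W> \<U> p"
  shows "((\<U>, c), (\<W>, nerve_pullback \<W> n p c)) \<in> cech_rel X n"
proof (rule cech_relI[OF assms(1) _ assms(2,3) refinement_id])
  have c: "c \<in> nerve_cocycles \<U> n" using assms(1) by (simp add: cech_cocycles_iff)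
  have d: "nerve_pullback \<W> n p c \<in> nerve_cocycles \<W> n"
    by (rule pullback_cocycle[OF assms(3) c])
  then show "(\<W>, nerve_pullback \<W> n p c) \<in> cech_cocycles X n"
    using assms(2) by (simp add: cech_cocycles_iff)
  show "(\<lambda>s. nerve_pullback \<W> n p c s - nerve_pullback \<W> n id (nerve_pullback \<W> n p c) s)
      \<in> nerve_coboundaries \<W> n"
    by (simp only: pullback_id[OF d] diff_self zero_coboundary)
qed

abbreviation cech_class ::
    "'a topology \<Rightarrow> nat \<Rightarrow> 'a set set \<Rightarrow> ('a set list \<Rightarrow> int) \<Rightarrow> ('a set set \<times> ('a set list \<Rightarrow> int)) set"
  where "cech_class X n \<U> c \<equiv> cech_rel X n `` {(\<U>, c)}"

lemma cech_class_eq_iff: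
  assumes "(\<U>, c) \<in> cech_cocycles X n" "(\<V>, d) \<in> cech_cocycles X n"
  shows "cech_class X n \<U> c = cech_class X n \<V> d \<longleftrightarrow> ((\<U>, c), (\<V>, d)) \<in> cech_rel X n"
  using assms by (simp add: eq_equiv_class_iff[OF equiv_cech_rel])

lemma cech_mult_class:
  assumes U: "(\<U>, c) \<in> cech_cocycles X n" and V: "(\<V>, d) \<in> cech_cocycles X n"
    and W: "open_cover X \<W>" "refinement_map \<W> \<U> p" "refinement_map \<W> \<V> q"
  shows "cech_class X n \<U> c \<otimes>\<^bsub>cech_cohomology X n\<^esub> cech_class X n \<V> d =
    cech_class X n \<W> (\<lambda>s. nerve_pullback \<W> n p c s + nerve_pullback \<W> n q d s)"
    (is "_ = ?R")
proof -
  let ?sum = "\<lambda>\<W> p q c d s. nerve_pullback \<W> n p c s + nerve_pullback \<W> n q d s"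
  have symD': "(y, x) \<in> cech_rel X n" if "(x, y) \<in> cech_rel X n" for x y
    using that equiv_cech_rel[of X n] by (meson equivE symD)
  have transD': "(x, z) \<in> cech_rel X n" if "(x, y) \<in> cech_rel X n" "(y, z) \<in> cech_rel X n" for x y z
    using that equiv_cech_rel[of X n] by (meson equivE transD)
  have *: "cech_class X n \<W>' (?sum \<W>' p' q' c' d') = ?R"
    if c': "(\<U>', c') \<in> cech_class X n \<U> c" and d': "(\<V>', d') \<in> cech_class X n \<V> d"
      and W': "open_cover X \<W>'" "refinement_map \<W>' \<U>' p'" "refinement_map \<W>' \<V>' q'"
    for \<U>' c' \<V>' d' \<W>' p' q'
  proof -
    have in': "(\<U>', c') \<in> cech_cocycles X n" "(\<V>', d') \<in> cech_cocycles X n"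
      using c' d' by (auto simp: cech_rel_def)
    have "((\<W>', nerve_pullback \<W>' n p' c'), (\<W>, nerve_pullback \<W> n p c)) \<in> cech_rel X n"
      using cech_rel_pullback[OF in'(1) W'(1,2)] cech_rel_pullback[OF U W(1,2)] c'
      by (meson symD' transD' Image_singleton_iff)
    moreover have "((\<W>', nerve_pullback \<W>' n q' d'), (\<W>, nerve_pullback \<W> n q d)) \<in> cech_rel X n"
      using cech_rel_pullback[OF in'(2) W'(1,3)] cech_rel_pullback[OF V W(1,3)] d'
      by (meson symD' transD' Image_singleton_iff)
    ultimately have "((\<W>', ?sum \<W>' p' q' c' d'), (\<W>, ?sum \<W> p q c d)) \<in> cech_rel X n"
      by (rule cech_rel_add)
    then show ?thesis by (rule equiv_class_eq[OF equiv_cech_rel])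
  qed
  have self: "(\<U>, c) \<in> cech_class X n \<U> c" "(\<V>, d) \<in> cech_class X n \<V> d"
    using equiv_class_self[OF equiv_cech_rel U] equiv_class_self[OF equiv_cech_rel V] .
  have "{cech_rel X n `` {(\<W>, ?sum \<W> p q c' d')}
      | \<U>' c' \<V>' d' \<W> p q. (\<U>', c') \<in> cech_class X n \<U> c \<and> (\<V>', d') \<in> cech_class X n \<V> d \<and>
         open_cover X \<W> \<and> refinement_map \<W> \<U>' p \<and> refinement_map \<W> \<V>' q} = {?R}"
    (is "?S = _")
  proof (rule antisym)
    show "?S \<subseteq> {?R}"
    proof
      fix y assume "y \<in> ?S"
      then show "y \<in> {?R}"
        by (elim CollectE exE conjE, hypsubst, unfold singleton_iff, intro *)
    qed
    have "?R \<in> ?S" using self W by (intro CollectI exI conjI) (rule refl)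
    then show "{?R} \<subseteq> ?S" by (simp only: insert_subset empty_subsetI simp_thms)
  qed
  then show ?thesis
    by (simp only: cech_cohomology_def monoid.simps cSup_singleton)
qed

lemma cech_mult_same:
  assumes "(\<W>, c) \<in> cech_cocycles X n" "(\<W>, d) \<in> cech_cocycles X n"
  shows "cech_class X n \<W> c \<otimes>\<^bsub>cech_cohomology X n\<^esub> cech_class X n \<W> d =
    cech_class X n \<W> (\<lambda>s. c s + d s)"
proof -
  have "open_cover X \<W>" "c \<in> nerve_cocycles \<W> n" "d \<in> nerve_cocycles \<W> n"
    using assms by (simp_all add: cech_cocycles_iff)
  then show ?thesis
    using cech_mult_class[OF assms _ refinement_id refinement_id] by (simp only: pullback_id)
qed

lemma cech_carrier: "carrier (cech_cohomology X n) = cech_cocycles X n // cech_rel X n"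
  by (simp add: cech_cohomology_def)

lemma cech_class_carrier:
  "(\<U>, c) \<in> cech_cocycles X n \<Longrightarrow> cech_class X n \<U> c \<in> carrier (cech_cohomology X n)"
  by (simp add: cech_carrier quotientI)

lemma cech_carrierE:
  assumes "A \<in> carrier (cech_cohomology X n)"
  obtains \<U> c where "(\<U>, c) \<in> cech_cocycles X n" "A = cech_class X n \<U> c"
  using assms unfolding cech_carrier by (metis quotientE surj_pair)

lemma cech_class_refine:
  assumes "(\<U>, c) \<in> cech_cocycles X n" "open_cover X \<W>" "refinement_map \<W> \<U> p"
  obtains d where "(\<W>, d) \<in> cech_cocycles X n" "cech_class X n \<U> c = cech_class X n \<W> d"
proof (rule that)
  show "(\<W>, nerve_pullback \<W> n p c) \<in> cech_cocycles X n"
    using cech_rel_pullback[OF assms] by (simp add: cech_rel_def)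
  show "cech_class X n \<U> c = cech_class X n \<W> (nerve_pullback \<W> n p c)"
    by (rule equiv_class_eq[OF equiv_cech_rel cech_rel_pullback[OF assms]])
qed

lemma cech_common2:
  assumes "A \<in> carrier (cech_cohomology X n)" "B \<in> carrier (cech_cohomology X n)"
  obtains \<W> c d where "(\<W>, c) \<in> cech_cocycles X n" "(\<W>, d) \<in> cech_cocycles X n"
    "A = cech_class X n \<W> c" "B = cech_class X n \<W> d"
proof -
  obtain \<U> a where 1: "(\<U>, a) \<in> cech_cocycles X n" "A = cech_class X n \<U> a"
    using assms(1) by (rule cech_carrierE)
  obtain \<V> b where 2: "(\<V>, b) \<in> cech_cocycles X n" "B = cech_class X n \<V> b"
    using assms(2) by (rule cech_carrierE)
  obtain \<W> p q where W: "open_cover X \<W>" "refinement_map \<W> \<U> p" "refinement_map \<W> \<V> q"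
    using common_refinement[of X \<U> \<V>] 1(1) 2(1) unfolding cech_cocycles_iff by blast
  obtain c where "(\<W>, c) \<in> cech_cocycles X n" "cech_class X n \<U> a = cech_class X n \<W> c"
    by (rule cech_class_refine[OF 1(1) W(1,2)])
  moreover obtain d where "(\<W>, d) \<in> cech_cocycles X n" "cech_class X n \<V> b = cech_class X n \<W> d"
    by (rule cech_class_refine[OF 2(1) W(1,3)])
  ultimately show ?thesis
    using 1(2) 2(2) by (intro that) (simp_all only:)
qed

lemma cech_common3:
  assumes "A \<in> carrier (cech_cohomology X n)" "B \<in> carrier (cech_cohomology X n)"
    "C \<in> carrier (cech_cohomology X n)"
  obtains \<W> c d e where "(\<W>, c) \<in> cech_cocycles X n" "(\<W>, d) \<in> cech_cocycles X n"
    "(\<W>, e) \<in> cech_cocycles X n"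
    "A = cech_class X n \<W> c" "B = cech_class X n \<W> d" "C = cech_class X n \<W> e"
proof -
  obtain \<U> a b where 1: "(\<U>, a) \<in> cech_cocycles X n" "(\<U>, b) \<in> cech_cocycles X n"
    "A = cech_class X n \<U> a" "B = cech_class X n \<U> b"
    using assms(1,2) by (rule cech_common2)
  obtain \<V> e where 2: "(\<V>, e) \<in> cech_cocycles X n" "C = cech_class X n \<V> e"
    using assms(3) by (rule cech_carrierE)
  obtain \<W> p q where W: "open_cover X \<W>" "refinement_map \<W> \<U> p" "refinement_map \<W> \<V> q"
    using common_refinement[of X \<U> \<V>] 1(1) 2(1) unfolding cech_cocycles_iff by blast
  obtain c where "(\<W>, c) \<in> cech_cocycles X n" "cech_class X n \<U> a = cech_class X n \<W> c"
    by (rule cech_class_refine[OF 1(1) W(1,2)])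
  moreover obtain d where "(\<W>, d) \<in> cech_cocycles X n" "cech_class X n \<U> b = cech_class X n \<W> d"
    by (rule cech_class_refine[OF 1(2) W(1,2)])
  moreover obtain f where "(\<W>, f) \<in> cech_cocycles X n" "cech_class X n \<V> e = cech_class X n \<W> f"
    by (rule cech_class_refine[OF 2(1) W(1,3)])
  ultimately show ?thesis
    using 1(3,4) 2(2) by (intro that) (simp_all only:)
qed

lemma cech_one:
  assumes "open_cover X \<W>"
  shows "\<one>\<^bsub>cech_cohomology X n\<^esub> = cech_class X n \<W> (\<lambda>_. 0)"
proof -
  have top: "({topspace X}, \<lambda>_. 0) \<in> cech_cocycles X n"
    by (simp add: cech_cocycles_iff open_cover_def zero_cocycle)
  have r: "refinement_map \<W> {topspace X} (\<lambda>_. topspace X)"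
    using assms by (auto simp: refinement_map_def open_cover_def dest: openin_subset)
  show ?thesis
    using equiv_class_eq[OF equiv_cech_rel cech_rel_pullback[OF top assms r]]
    by (simp add: cech_cohomology_def nerve_pullback_def[abs_def])
qed

theorem comm_group_cech_cohomology: "comm_group (cech_cohomology X n)"
proof (rule comm_groupI)
  let ?G = "cech_cohomology X n"
  have cover: "open_cover X {topspace X}" by (simp add: open_cover_def)
  show "\<one>\<^bsub>?G\<^esub> \<in> carrier ?G"
    unfolding cech_one[OF cover]
    by (rule cech_class_carrier) (simp add: cech_cocycles_iff cover zero_cocycle)
  fix A assume A: "A \<in> carrier ?G"
  obtain \<U> c where c: "(\<U>, c) \<in> cech_cocycles X n" "A = cech_class X n \<U> c"
    using A by (rule cech_carrierE)
  then have U: "open_cover X \<U>" by (simp add: cech_cocycles_iff)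
  have z: "(\<U>, \<lambda>_. 0) \<in> cech_cocycles X n" using U by (simp add: cech_cocycles_iff zero_cocycle)
  show "\<one>\<^bsub>?G\<^esub> \<otimes>\<^bsub>?G\<^esub> A = A"
    unfolding cech_one[OF U] c(2) cech_mult_same[OF z c(1)] by simp
  have m: "(\<U>, \<lambda>s. - c s) \<in> cech_cocycles X n"
    using c(1) by (simp add: cech_cocycles_iff uminus_cocycle)
  show "\<exists>B\<in>carrier ?G. B \<otimes>\<^bsub>?G\<^esub> A = \<one>\<^bsub>?G\<^esub>"
  proof (rule bexI[OF _ cech_class_carrier[OF m]])
    show "cech_class X n \<U> (\<lambda>s. - c s) \<otimes>\<^bsub>?G\<^esub> A = \<one>\<^bsub>?G\<^esub>"
      unfolding c(2) cech_one[OF U] cech_mult_same[OF m c(1)] by simp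
  qed
  fix B assume B: "B \<in> carrier ?G"
  obtain \<V> d e where d: "(\<V>, d) \<in> cech_cocycles X n" and e: "(\<V>, e) \<in> cech_cocycles X n"
    and AB: "A = cech_class X n \<V> d" "B = cech_class X n \<V> e"
    using A B by (rule cech_common2)
  have de: "(\<V>, \<lambda>s. d s + e s) \<in> cech_cocycles X n"
    using d e by (simp add: cech_cocycles_iff add_cocycle)
  show "A \<otimes>\<^bsub>?G\<^esub> B \<in> carrier ?G"
    unfolding AB cech_mult_same[OF d e] by (rule cech_class_carrier[OF de])
  show "A \<otimes>\<^bsub>?G\<^esub> B = B \<otimes>\<^bsub>?G\<^esub> A"
    unfolding AB cech_mult_same[OF d e] cech_mult_same[OF e d] by (simp only: add.commute)
  fix C assume C: "C \<in> carrier ?G"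
  obtain \<W> c d e where *: "(\<W>, c) \<in> cech_cocycles X n" "(\<W>, d) \<in> cech_cocycles X n"
    "(\<W>, e) \<in> cech_cocycles X n"
    "A = cech_class X n \<W> c" "B = cech_class X n \<W> d" "C = cech_class X n \<W> e"
    using A B C by (rule cech_common3)
  have cd: "(\<W>, \<lambda>s. c s + d s) \<in> cech_cocycles X n"
    and de: "(\<W>, \<lambda>s. d s + e s) \<in> cech_cocycles X n"
    using *(1-3) by (simp_all add: cech_cocycles_iff add_cocycle)
  show "(A \<otimes>\<^bsub>?G\<^esub> B) \<otimes>\<^bsub>?G\<^esub> C = A \<otimes>\<^bsub>?G\<^esub> (B \<otimes>\<^bsub>?G\<^esub> C)"
    unfolding *(4-6) cech_mult_same[OF *(1,2)] cech_mult_same[OF *(2,3)]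
      cech_mult_same[OF cd *(3)] cech_mult_same[OF *(1) de] by (simp only: add.assoc)
qed

end

theory Submission
  imports Defs "HOL-Analysis.Urysohn" "HOL-Analysis.Complex_Transcendental"
begin

text \<open>
  Dimension: a continuous map \<open>h : M \<rightarrow> \<real>\<^sup>3\<close> is a traceless self-adjoint matrix \<open>H \<in> M\<^sub>2(C(M))\<close>. If
  \<open>U H U\<^sup>*\<close> is almost diagonal, then replacing its off-diagonal entries by a small constant
  \<open>\<delta> > 0\<close> moves \<open>H\<close> only slightly and makes it nowhere scalar. So nowhere vanishing maps are dense in
  \<open>C(M, \<real>\<^sup>3)\<close>. Applied to a partition of unity of a cover by four sets, viewed as a map to the
  3-simplex with the barycentre as origin, this produces a shrinking of the cover with empty
  intersection. Doing this for all quadruples of members of a finite cover yields \<open>dim M \<le> 2\<close>.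

  Cohomology: with a partition of unity \<open>\<phi>\<close>, a 2-cocycle \<open>c\<close> defines the line bundle with transition functions
  \<open>g\<^sub>i\<^sub>j = exp (2\<pi>\<i> \<Sum>\<^sub>k \<phi>\<^sub>k c\<^sub>k\<^sub>i\<^sub>j)\<close>, which is the range of the projection
  \<open>P\<^sub>i\<^sub>j = sqrt (\<phi>\<^sub>i \<phi>\<^sub>j) g\<^sub>i\<^sub>j\<close>. An almost diagonal rank one projection has at each point exactly one
  diagonal entry above 1/2; the corresponding row of the unitary is a nowhere vanishing
  section. Local logarithms of this section exhibit \<open>c\<close> as a coboundary on a refinement.
\<close>

section \<open>Entrywise approximate diagonalization\<close>

lemma mat_adjoint_carrier:
  "A \<in> carrier_mat m n \<Longrightarrow> mat_adjoint A \<in> carrier_mat n m"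
  by (auto simp: mat_adjoint_def)

lemma mat_adjoint_index:
  fixes A :: "complex mat"
  assumes "A \<in> carrier_mat m n" "i < n" "j < m"
  shows "mat_adjoint A $$ (i, j) = cnj (A $$ (j, i))"
  using assms by (simp add: mat_adjoint_def mat_of_rows_def)

lemma l2_norm_vec_L2_set: "l2_norm_vec v = L2_set (\<lambda>i. cmod (vec_index v i)) {..<dim_vec v}"
  by (simp add: l2_norm_vec_def L2_set_def)

text \<open>Vectors of the unit ball have coordinates of modulus at most 1. The crude bound serves
  to show that the set in \<open>op_norm_mat\<close> is bounded.\<close>

lemma l2_norm_mult_mat_vec_le:
  assumes A: "A \<in> carrier_mat m n" and v: "v \<in> carrier_vec n" and v1: "l2_norm_vec v \<le> 1"
  shows "l2_norm_vec (A *\<^sub>v v) \<le> (\<Sum>i<m. \<Sum>j<n. cmod (A $$ (i, j)))"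
proof -
  have vj: "cmod (vec_index v j) \<le> 1" if "j < n" for j
  proof -
    have "cmod (vec_index v j) \<le> l2_norm_vec v"
      unfolding l2_norm_vec_L2_set using that v by (intro member_le_L2_set) auto
    then show ?thesis using v1 by simp
  qed
  have "l2_norm_vec (A *\<^sub>v v) \<le> (\<Sum>i<m. cmod (vec_index (A *\<^sub>v v) i))"
    using A L2_set_le_sum[of "{..<m}" "\<lambda>i. cmod (vec_index (A *\<^sub>v v) i)"]
    unfolding l2_norm_vec_L2_set by simp
  also have "\<dots> \<le> (\<Sum>i<m. \<Sum>j<n. cmod (A $$ (i, j)))"
  proof (rule sum_mono)
    fix i assume i: "i \<in> {..<m}"
    have "vec_index (A *\<^sub>v v) i = (\<Sum>j<n. A $$ (i, j) * vec_index v j)"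
      using A v i by (simp add: scalar_prod_def lessThan_atLeast0)
    also have "cmod \<dots> \<le> (\<Sum>j<n. cmod (A $$ (i, j)) * cmod (vec_index v j))"
      by (simp add: norm_sum norm_mult[symmetric])
    also have "\<dots> \<le> (\<Sum>j<n. cmod (A $$ (i, j)))"
      by (intro sum_mono) (simp add: vj mult_left_le)
    finally show "cmod (vec_index (A *\<^sub>v v) i) \<le> (\<Sum>j<n. cmod (A $$ (i, j)))" .
  qed
  finally show ?thesis .
qed

lemma op_norm_mat_le:
  assumes A: "A \<in> carrier_mat m n"
  shows "op_norm_mat A \<le> (\<Sum>i<m. \<Sum>j<n. cmod (A $$ (i, j)))"
  unfolding op_norm_mat_def
proof (rule cSup_least)
  have "l2_norm_vec (0\<^sub>v (dim_col A)) \<le> 1" by (simp add: l2_norm_vec_def)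
  then show "{l2_norm_vec (A *\<^sub>v v) |v. v \<in> carrier_vec (dim_col A) \<and> l2_norm_vec v \<le> 1} \<noteq> {}"
    using zero_carrier_vec by blast
qed (use A l2_norm_mult_mat_vec_le[OF A] in auto)

text \<open>Column \<open>j\<close> is the image of a unit vector, so its norm is among those in the
  supremum.\<close>

lemma norm_entry_le_op_norm_mat:
  assumes A: "A \<in> carrier_mat m n" and i: "i < m" and j: "j < n"
  shows "cmod (A $$ (i, j)) \<le> op_norm_mat A"
proof -
  let ?v = "unit_vec n j :: complex Matrix.vec"
  have v: "?v \<in> carrier_vec n" by simp
  have eq: "vec_index (A *\<^sub>v ?v) i = A $$ (i, j)"
    using A i j by simp
  have "(\<Sum>k<n. (cmod (vec_index ?v k))\<^sup>2) = (\<Sum>k<n. if k = j then 1 else 0)"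
    using j by (intro sum.cong) auto
  then have v1: "l2_norm_vec ?v \<le> 1"
    using j by (simp add: l2_norm_vec_def)
  have "cmod (vec_index (A *\<^sub>v ?v) i) \<le> l2_norm_vec (A *\<^sub>v ?v)"
    unfolding l2_norm_vec_L2_set using A i by (intro member_le_L2_set) auto
  also have "\<dots> \<le> op_norm_mat A"
    unfolding op_norm_mat_def
  proof (rule cSup_upper)
    show "bdd_above {l2_norm_vec (A *\<^sub>v v) |v. v \<in> carrier_vec (dim_col A) \<and> l2_norm_vec v \<le> 1}"
      by (rule bdd_aboveI[where M = "\<Sum>i<m. \<Sum>j<n. cmod (A $$ (i, j))"])
        (use A l2_norm_mult_mat_vec_le[OF A] in auto)
  qed (use A v v1 in auto)
  finally show ?thesis by (simp only: eq)
qed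

lemma continuous_map_mult_complex [continuous_intros]:
  fixes f g :: "'a \<Rightarrow> complex"
  assumes "continuous_map X euclidean f" "continuous_map X euclidean g"
  shows "continuous_map X euclidean (\<lambda>x. f x * g x)"
  using assms by (simp add: continuous_map_atin tendsto_mult)

lemma continuous_map_isCont_compose:
  assumes "continuous_map X euclidean f" "\<And>y. isCont g y"
  shows "continuous_map X euclidean (\<lambda>x. g (f x))"
  using continuous_map_compose[OF assms(1), of euclidean g] assms(2)
  by (simp add: o_def continuous_at_imp_continuous_on)

text \<open>A real \<open>Sup\<close> dominates the members of its set only if the set is bounded.
  Compactness provides this: the sum of the moduli of the entries is continuous, hence bounded on
  \<open>M\<close>, and dominates the operator norms.\<close>

lemma norm_less_of_sup_op_norm:
  assumes M: "compact_space M" and F: "\<And>x. x \<in> topspace M \<Longrightarrow> F x \<in> carrier_mat m n"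
    and cont: "\<And>i j. i < m \<Longrightarrow> j < n \<Longrightarrow> continuous_map M euclidean (\<lambda>x. F x $$ (i, j))"
    and less: "sup_op_norm M F < \<epsilon>"
    and x: "x \<in> topspace M" and ij: "i < m" "j < n"
  shows "cmod (F x $$ (i, j)) < \<epsilon>"
proof -
  have c: "continuous_map M euclideanreal (\<lambda>x. \<Sum>i<m. \<Sum>j<n. cmod (F x $$ (i, j)))"
    by (intro continuous_map_sum continuous_map_norm cont) auto
  have "compactin euclideanreal ((\<lambda>x. \<Sum>i<m. \<Sum>j<n. cmod (F x $$ (i, j))) ` topspace M)"
    by (rule image_compactin[OF _ c]) (use M in \<open>simp add: compact_space_def\<close>)
  then have "bounded ((\<lambda>x. \<Sum>i<m. \<Sum>j<n. cmod (F x $$ (i, j))) ` topspace M)"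
    by (simp add: compact_imp_bounded)
  then obtain B where B: "\<And>x. x \<in> topspace M \<Longrightarrow> (\<Sum>i<m. \<Sum>j<n. cmod (F x $$ (i, j))) \<le> B"
    using bounded_has_Sup(1) by (meson bdd_above.unfold bounded_imp_bdd_above imageI)
  have "bdd_above (insert 0 ((\<lambda>x. op_norm_mat (F x)) ` topspace M))"
    unfolding bdd_above_insert
    by (rule bdd_aboveI[where M = B]) (use op_norm_mat_le[OF F] B in \<open>force intro: order_trans\<close>)
  then have "op_norm_mat (F x) \<le> sup_op_norm M F"
    unfolding sup_op_norm_def using x by (intro cSup_upper) auto
  with norm_entry_le_op_norm_mat[OF F[OF x] ij] less show ?thesis by simp
qed

text \<open>Translates the hypothesis from matrices to scalar functions. Of the diagonalization only
  the smallness of the off-diagonal entries is kept; row orthonormality serves the dimension bound,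
  column orthonormality the cohomology.\<close>

lemma approx_diagonal_entries:
  fixes A :: "nat \<Rightarrow> nat \<Rightarrow> 'a \<Rightarrow> complex"
  assumes M: "compact_space M" and AD: "approx_diagonal M" and n: "n \<ge> 2" and \<epsilon>: "\<epsilon> > 0"
    and contA: "\<And>i j. i < n \<Longrightarrow> j < n \<Longrightarrow> continuous_map M euclidean (A i j)"
    and herm: "\<And>x i j. x \<in> topspace M \<Longrightarrow> i < n \<Longrightarrow> j < n \<Longrightarrow> A j i x = cnj (A i j x)"
  obtains u :: "nat \<Rightarrow> nat \<Rightarrow> 'a \<Rightarrow> complex"
  where "\<And>i j. i < n \<Longrightarrow> j < n \<Longrightarrow> continuous_map M euclidean (u i j)"
    and "\<And>x i j. x \<in> topspace M \<Longrightarrow> i < n \<Longrightarrow> j < n \<Longrightarrow>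
          (\<Sum>k<n. u i k x * cnj (u j k x)) = (if i = j then 1 else 0)"
    and "\<And>x i j. x \<in> topspace M \<Longrightarrow> i < n \<Longrightarrow> j < n \<Longrightarrow>
          (\<Sum>k<n. cnj (u k i x) * u k j x) = (if i = j then 1 else 0)"
    and "\<And>x i j. x \<in> topspace M \<Longrightarrow> i < n \<Longrightarrow> j < n \<Longrightarrow> i \<noteq> j \<Longrightarrow>
          cmod (\<Sum>k<n. \<Sum>l<n. u i k x * A k l x * cnj (u j l x)) < \<epsilon>"
proof -
  define B where "B = Matrix.mat n n (\<lambda>(i, j). A i j)"
  have B: "B \<in> cfun_mats M n"
    using contA by (auto simp: B_def cfun_mats_def cfun_alg_def)
  have evB: "eval_mat B x = Matrix.mat n n (\<lambda>(i, j). A i j x)" for x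
    by (auto simp: eval_mat_def B_def)
  have evBc: "eval_mat B x \<in> carrier_mat n n" for x
    by (simp add: evB)
  have "self_adjoint_on M B"
    unfolding self_adjoint_on_def
  proof
    fix x assume x: "x \<in> topspace M"
    show "mat_adjoint (eval_mat B x) = eval_mat B x"
    proof (rule eq_matI)
      fix i j assume "i < dim_row (eval_mat B x)" "j < dim_col (eval_mat B x)"
      then have "i < n" "j < n" by (auto simp: evB)
      then show "mat_adjoint (eval_mat B x) $$ (i, j) = eval_mat B x $$ (i, j)"
        using herm[OF x, of j i] mat_adjoint_index[OF evBc, of i j x] by (simp add: evB)
    qed (use mat_adjoint_carrier[OF evBc[of x]] evBc[of x] in auto)
  qed
  with AD n B have "approx_diagonalizable M n B" by (simp add: approx_diagonal_def)
  with \<epsilon> obtain U a where U: "U \<in> cfun_unitaries M n" and a: "\<And>i. i < n \<Longrightarrow> a i \<in> cfun_alg M"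
    and less: "sup_op_norm M (\<lambda>x. eval_mat U x * eval_mat B x * mat_adjoint (eval_mat U x)
                          - mat_diag n (\<lambda>i. a i x)) < \<epsilon>" (is "sup_op_norm M ?F < \<epsilon>")
    unfolding approx_diagonalizable_def by blast
  define u where "u = (\<lambda>i j. U $$ (i, j))"
  have Uc: "U \<in> carrier_mat n n" and contu: "\<And>i j. i < n \<Longrightarrow> j < n \<Longrightarrow> continuous_map M euclidean (u i j)"
    using U by (auto simp: cfun_unitaries_def cfun_mats_def cfun_alg_def u_def)
  have evUc: "eval_mat U x \<in> carrier_mat n n" for x
    using Uc by (simp add: eval_mat_def)
  have evU: "eval_mat U x $$ (i, j) = u i j x" if "i < n" "j < n" for i j x
    using that Uc by (simp add: eval_mat_def u_def)
  have adj: "mat_adjoint (eval_mat U x) $$ (i, j) = cnj (u j i x)" if "i < n" "j < n" for i j x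
    using that by (simp add: mat_adjoint_index[OF evUc] evU)
  note adjc = mat_adjoint_carrier[OF evUc]
  have mult: "(P * Q) $$ (i, j) = (\<Sum>k<n. P $$ (i, k) * Q $$ (k, j))"
    if "P \<in> carrier_mat n n" "Q \<in> carrier_mat n n" "i < n" "j < n" for P Q :: "complex mat" and i j
    using that by (simp add: scalar_prod_def lessThan_atLeast0)
  have UBU: "(eval_mat U x * eval_mat B x * mat_adjoint (eval_mat U x)) $$ (i, j) =
      (\<Sum>k<n. \<Sum>l<n. u i k x * A k l x * cnj (u j l x))" if ij: "i < n" "j < n" for i j x
  proof -
    have "(eval_mat U x * eval_mat B x * mat_adjoint (eval_mat U x)) $$ (i, j) =
        (\<Sum>l<n. (\<Sum>k<n. u i k x * A k l x) * cnj (u j l x))"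
      unfolding mult[OF mult_carrier_mat[OF evUc evBc] adjc ij]
    proof (intro sum.cong refl)
      fix l assume "l \<in> {..<n}"
      then have l: "l < n" by simp
      have "(eval_mat U x * eval_mat B x) $$ (i, l) = (\<Sum>k<n. u i k x * A k l x)"
        unfolding mult[OF evUc evBc ij(1) l] using ij l by (simp add: evU) (simp add: evB)
      then show "(eval_mat U x * eval_mat B x) $$ (i, l) * mat_adjoint (eval_mat U x) $$ (l, j) =
          (\<Sum>k<n. u i k x * A k l x) * cnj (u j l x)"
        by (simp only: adj[OF l ij(2)])
    qed
    also have "\<dots> = (\<Sum>k<n. \<Sum>l<n. u i k x * A k l x * cnj (u j l x))"
      unfolding sum_distrib_right by (rule sum.swap)
    finally show ?thesis .
  qed
  have Fc: "?F x \<in> carrier_mat n n" for x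
    by (rule minus_carrier_mat) (simp add: mat_diag_def)
  have F: "?F x $$ (i, j) = (\<Sum>k<n. \<Sum>l<n. u i k x * A k l x * cnj (u j l x))
      - (if i = j then a j x else 0)" if "i < n" "j < n" for i j x
  proof -
    have "?F x $$ (i, j) = (eval_mat U x * eval_mat B x * mat_adjoint (eval_mat U x)) $$ (i, j)
        - mat_diag n (\<lambda>i. a i x) $$ (i, j)"
      by (rule index_minus_mat) (use that in \<open>simp_all add: mat_diag_def\<close>)
    then show ?thesis
      using that by (simp only: UBU) (simp add: mat_diag_def)
  qed
  show thesis
  proof (rule that[of u])
    fix x i j assume x: "x \<in> topspace M" and ij: "i < n" "j < n"
    have "(eval_mat U x * mat_adjoint (eval_mat U x)) $$ (i, j) = 1\<^sub>m n $$ (i, j)"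
      and "(mat_adjoint (eval_mat U x) * eval_mat U x) $$ (i, j) = 1\<^sub>m n $$ (i, j)"
      using U x by (auto simp: cfun_unitaries_def)
    then show "(\<Sum>k<n. u i k x * cnj (u j k x)) = (if i = j then 1 else 0)"
      and "(\<Sum>k<n. cnj (u k i x) * u k j x) = (if i = j then 1 else 0)"
      using ij by (simp_all add: mult[OF evUc adjc] mult[OF adjc evUc] evU adj del: index_mult_mat)
    assume ne: "i \<noteq> j"
    \<comment> \<open>For \<open>i \<noteq> j\<close> the subtracted diagonal matrix contributes 0,
      so this is an entry of the conjugated matrix itself.\<close>
    have "cmod (?F x $$ (i, j)) < \<epsilon>"
    proof (rule norm_less_of_sup_op_norm[OF M Fc _ less x ij])
      fix i j assume ij: "i < n" "j < n"
      have "continuous_map M euclidean (\<lambda>x. if i = j then a j x else 0)"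
        using a[OF ij(2)] by (cases "i = j") (auto simp: cfun_alg_def)
      then show "continuous_map M euclidean (\<lambda>x. ?F x $$ (i, j))"
        unfolding F[OF ij] using ij
        by (intro continuous_intros continuous_map_isCont_compose[where g = cnj] contu contA) auto
    qed
    with ne show "cmod (\<Sum>k<n. \<Sum>l<n. u i k x * A k l x * cnj (u j l x)) < \<epsilon>"
      by (simp only: F[OF ij]) simp
  qed (rule contu)
qed

section \<open>Partitions of unity\<close>

text \<open>Complete regularity gives bump functions, compactness finitely many whose positivity
  sets cover, and division by their sum normalizes. The indices below \<open>n\<close> later label
  rows and columns of a matrix, hence \<open>n \<ge> 2\<close>; \<open>V\<close> may repeat
  members.\<close>

lemma compact_Hausdorff_partition_of_unity:
  assumes M: "compact_space M" "Hausdorff_space M" and U: "open_cover M \<U>" and ne: "topspace M \<noteq> {}"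
  obtains n :: nat and \<phi> :: "nat \<Rightarrow> 'a \<Rightarrow> real" and V :: "nat \<Rightarrow> 'a set"
  where "n \<ge> 2" "\<And>k. k < n \<Longrightarrow> V k \<in> \<U>"
    and "\<And>k. k < n \<Longrightarrow> continuous_map M euclideanreal (\<phi> k)"
    and "\<And>k x. k < n \<Longrightarrow> x \<in> topspace M \<Longrightarrow> \<phi> k x \<ge> 0"
    and "\<And>k x. k < n \<Longrightarrow> x \<in> topspace M \<Longrightarrow> x \<notin> V k \<Longrightarrow> \<phi> k x = 0"
    and "\<And>x. x \<in> topspace M \<Longrightarrow> (\<Sum>k<n. \<phi> k x) = 1"
proof -
  have cr: "completely_regular_space M"
    using M by (simp add: compact_Hausdorff_or_regular_imp_normal_space
        normal_imp_completely_regular_space_A Hausdorff_imp_t1_space)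
  define P where "P = (\<lambda>x V (g :: 'a \<Rightarrow> real). V \<in> \<U> \<and> continuous_map M euclideanreal g \<and> g x > 0 \<and>
      (\<forall>y\<in>topspace M. g y \<ge> 0) \<and> (\<forall>y\<in>topspace M - V. g y = 0))"
  have "\<exists>V g. P x V g" if x: "x \<in> topspace M" for x
  proof -
    obtain V where V: "V \<in> \<U>" "x \<in> V" "openin M V"
      using U x by (auto simp: open_cover_def)
    then obtain f where f: "continuous_map M euclideanreal f" "f x = 0" "f ` (topspace M - V) \<subseteq> {1}"
      using cr unfolding completely_regular_space_alt' by blast
    show ?thesis
      unfolding P_def
    proof (intro exI conjI ballI)
      \<comment> \<open>\<open>f\<close> is 0 at \<open>x\<close> and 1 off \<open>V\<close> but may
        exceed 1 elsewhere, hence the truncation.\<close>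
      show "continuous_map M euclideanreal (\<lambda>y. max 0 (1 - f y))"
        by (intro continuous_intros f)
    qed (use V f in auto)
  qed
  then obtain W g where WP: "\<And>x. x \<in> topspace M \<Longrightarrow> P x (W x) (g x)"
    by metis
  have W: "\<And>x. x \<in> topspace M \<Longrightarrow> W x \<in> \<U>"
    and g: "\<And>x. x \<in> topspace M \<Longrightarrow> continuous_map M euclideanreal (g x)"
      "\<And>x. x \<in> topspace M \<Longrightarrow> g x x > (0::real)"
      "\<And>x y. x \<in> topspace M \<Longrightarrow> y \<in> topspace M \<Longrightarrow> g x y \<ge> 0"
      "\<And>x y. x \<in> topspace M \<Longrightarrow> y \<in> topspace M \<Longrightarrow> y \<notin> W x \<Longrightarrow> g x y = 0"
    using WP by (auto simp: P_def)
  have op: "openin M {y \<in> topspace M. 0 < g x y}" if "x \<in> topspace M" for x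
    using g(1)[OF that] unfolding continuous_map_upper_lower_semicontinuous_lt by blast
  have "topspace M \<subseteq> \<Union>((\<lambda>x. {y \<in> topspace M. 0 < g x y}) ` topspace M)"
    using g(2) by blast
  with op M(1) obtain F where F: "finite F" "F \<subseteq> (\<lambda>x. {y \<in> topspace M. 0 < g x y}) ` topspace M"
      "topspace M \<subseteq> \<Union>F"
    unfolding compact_space_alt by (metis (no_types, lifting) imageE)
  then obtain C where C: "finite C" "C \<subseteq> topspace M" "F = (\<lambda>x. {y \<in> topspace M. 0 < g x y}) ` C"
    by (meson finite_subset_image)
  obtain xs where xs: "set xs = C" using C(1) finite_list by blast
  obtain x0 where x0: "x0 \<in> topspace M" using ne by blast
  \<comment> \<open>Listing \<open>x0\<close> twice forces length at least 2, however few points the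
    subcover needs.\<close>
  define p where "p = x0 # x0 # xs"
  have pM: "p ! k \<in> topspace M" if "k < length p" for k
    using nth_mem[OF that] C(2) xs x0 by (auto simp: p_def)
  define G where "G = (\<lambda>x. \<Sum>k<length p. g (p ! k) x)"
  have Gpos: "G x > 0" if x: "x \<in> topspace M" for x
  proof -
    obtain y where "y \<in> C" "g y x > 0" using F(3) C(3) x by blast
    then obtain k where "k < length p" "g (p ! k) x > 0"
      using xs by (metis in_set_conv_nth list.set_intros(2) p_def)
    then show ?thesis
      unfolding G_def using pM g(3) x by (intro sum_pos2[where i = k]) auto
  qed
  have contG: "continuous_map M euclideanreal G"
    unfolding G_def by (intro continuous_map_sum g pM) auto
  show thesis
  proof (rule that[of "length p" "\<lambda>k. W (p ! k)" "\<lambda>k x. g (p ! k) x / G x"])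
    show "2 \<le> length p" by (simp add: p_def)
    fix x assume x: "x \<in> topspace M"
    show "(\<Sum>k<length p. g (p ! k) x / G x) = 1"
      using Gpos[OF x] unfolding sum_divide_distrib[symmetric] by (simp add: G_def)
  next
    fix k assume k: "k < length p"
    show "continuous_map M euclideanreal (\<lambda>x. g (p ! k) x / G x)"
      using Gpos by (intro continuous_map_real_divide g contG pM k) force
  qed (use W g pM Gpos in \<open>auto simp: less_imp_le\<close>)
qed

section \<open>Covering dimension\<close>

text \<open>The three functions are the Pauli coordinates of a traceless Hermitian 2 by 2 matrix
  \<open>H\<close>. A Hermitian matrix is scalar exactly when its Pauli coordinates vanish, so it
  suffices to move \<open>H\<close> slightly to a nowhere scalar matrix, which is easy in an almost
  diagonalizing frame.\<close>

lemma approx_diagonal_nonvanishing: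
  fixes h1 h2 h3 :: "'a \<Rightarrow> real"
  assumes M: "compact_space M" and AD: "approx_diagonal M" and \<epsilon>: "\<epsilon> > 0"
    and h: "continuous_map M euclideanreal h1" "continuous_map M euclideanreal h2"
      "continuous_map M euclideanreal h3"
  obtains k1 k2 k3 :: "'a \<Rightarrow> real"
  where "continuous_map M euclideanreal k1" "continuous_map M euclideanreal k2"
      "continuous_map M euclideanreal k3"
    and "\<And>x. x \<in> topspace M \<Longrightarrow> \<bar>k1 x - h1 x\<bar> < \<epsilon> \<and> \<bar>k2 x - h2 x\<bar> < \<epsilon> \<and> \<bar>k3 x - h3 x\<bar> < \<epsilon>"
    and "\<And>x. x \<in> topspace M \<Longrightarrow> k1 x \<noteq> 0 \<or> k2 x \<noteq> 0 \<or> k3 x \<noteq> 0"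
proof -
  define H where "H = (\<lambda>(i::nat) (j::nat) x. if i = 0 then if j = 0 then complex_of_real (h3 x) else Complex (h1 x) (- h2 x)
     else if j = 0 then Complex (h1 x) (h2 x) else - complex_of_real (h3 x))"
  \<comment> \<open>The correction \<open>D\<close> below has entries of modulus less than
    \<open>4 * \<delta>\<close>, which is below \<open>\<epsilon>\<close>.\<close>
  define \<delta> where "\<delta> = \<epsilon> / 5"
  have \<delta>: "\<delta> > 0" using \<epsilon> by (simp add: \<delta>_def)
  have cc: "continuous_map M euclidean (\<lambda>x. complex_of_real (f x))"
    if "continuous_map M euclideanreal f" for f
    using that by (rule continuous_map_isCont_compose) (intro continuous_intros)
  have contH: "continuous_map M euclidean (H i j)" for i j
    unfolding H_def
    by (cases "i = 0"; cases "j = 0"; simp add: Complex_eq)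
      (intro continuous_intros cc h continuous_map_mult_complex)+
  have herm: "H j i x = cnj (H i j x)" for i j x
    by (simp add: H_def complex_eq_iff)
  obtain u :: "nat \<Rightarrow> nat \<Rightarrow> 'a \<Rightarrow> complex" where u: "\<And>i j. i < 2 \<Longrightarrow> j < 2 \<Longrightarrow> continuous_map M euclidean (u i j)"
    and row: "\<And>x i j. x \<in> topspace M \<Longrightarrow> i < 2 \<Longrightarrow> j < 2 \<Longrightarrow>
          (\<Sum>k<2. u i k x * cnj (u j k x)) = (if i = j then 1 else 0)"
    and "\<And>x i j. x \<in> topspace M \<Longrightarrow> i < 2 \<Longrightarrow> j < 2 \<Longrightarrow>
          (\<Sum>k<2. cnj (u k i x) * u k j x) = (if i = j then 1 else 0)"
    and off: "\<And>x i j. x \<in> topspace M \<Longrightarrow> i < 2 \<Longrightarrow> j < 2 \<Longrightarrow> i \<noteq> j \<Longrightarrow>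
          cmod (\<Sum>k<2. \<Sum>l<2. u i k x * H k l x * cnj (u j l x)) < \<delta>"
    by (rule approx_diagonal_entries[OF M AD order_refl \<delta> contH herm]) (rule that)
  \<comment> \<open>\<open>z\<close> is the upper right entry of \<open>K = U H U\<^sup>*\<close>, and \<open>D = U\<^sup>* K' U - H\<close> where \<open>K'\<close> is \<open>K\<close> with both
    off-diagonal entries replaced by \<open>\<delta>\<close>; such a \<open>K'\<close> is never a scalar matrix.\<close>
  define z where "z = (\<lambda>x. \<Sum>k<2. \<Sum>l<2. u 0 k x * H k l x * cnj (u 1 l x))"
  define e where "e = (\<lambda>x. complex_of_real \<delta> - z x)"
  define D where "D = (\<lambda>i j x. cnj (u 0 i x) * e x * u 1 j x + cnj (u 1 i x) * cnj (e x) * u 0 j x)"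
  have conte: "continuous_map M euclidean e"
    unfolding e_def z_def
    by (intro continuous_intros continuous_map_mult_complex continuous_map_isCont_compose[where g = cnj] contH u) auto
  have contD: "continuous_map M euclidean (D i j)" if "i < 2" "j < 2" for i j
    unfolding D_def using that
    by (intro continuous_intros continuous_map_mult_complex continuous_map_isCont_compose[where g = cnj] conte u) auto
  have contRe: "continuous_map M euclideanreal (\<lambda>x. Re (D i j x))"
    and contIm: "continuous_map M euclideanreal (\<lambda>x. Im (D i j x))" if "i < 2" "j < 2" for i j
    using contD[OF that]
    by (auto intro: continuous_map_isCont_compose[where g = Re] continuous_map_isCont_compose[where g = Im])
  have e: "cmod (e x) < 2 * \<delta>" if x: "x \<in> topspace M" for x
  proof -
    have "cmod (z x) < \<delta>" using off[OF x, of 0 1] by (simp add: z_def)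
    moreover have "cmod (e x) \<le> cmod (complex_of_real \<delta>) + cmod (z x)"
      unfolding e_def by (rule norm_triangle_ineq4)
    ultimately show ?thesis using \<delta> by simp
  qed
  have u1: "cmod (u i j x) \<le> 1" if x: "x \<in> topspace M" and ij: "i < 2" "j < 2" for x i j
  proof -
    have "complex_of_real (\<Sum>k<2. (cmod (u i k x))\<^sup>2) = 1"
      using row[OF x ij(1) ij(1)] by (simp add: complex_norm_square del: of_real_power)
    then have "(\<Sum>k<2. (cmod (u i k x))\<^sup>2) = 1"
      using of_real_eq_1_iff by blast
    moreover have "(cmod (u i j x))\<^sup>2 \<le> (\<Sum>k<2. (cmod (u i k x))\<^sup>2)"
      using ij by (intro member_le_sum) auto
    ultimately show ?thesis
      by (metis norm_ge_zero one_power2 power2_le_imp_le zero_le_one)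
  qed
  have D: "cmod (D i j x) < 4 * \<delta>" if x: "x \<in> topspace M" and ij: "i < 2" "j < 2" for x i j
  proof -
    have t: "cmod (cnj (u p i x) * w * u q j x) \<le> cmod w" if "p < 2" "q < 2" for p q w
    proof -
      have "cmod (u p i x) * cmod w * cmod (u q j x) \<le> 1 * cmod w * 1"
        using u1[OF x] that ij by (intro mult_mono) auto
      then show ?thesis by (simp add: norm_mult)
    qed
    have "cmod (D i j x) \<le> cmod (e x) + cmod (cnj (e x))"
      unfolding D_def by (rule norm_triangle_le, rule add_mono; rule t) auto
    then show ?thesis using e[OF x] by simp
  qed
  \<comment> \<open>These are the Pauli coordinates of \<open>H + D\<close>. Half the difference of
    the diagonal entries gives the third one whatever the trace is.\<close>
  define k1 where "k1 = (\<lambda>x. h1 x + Re (D 0 1 x))"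
  define k2 where "k2 = (\<lambda>x. h2 x - Im (D 0 1 x))"
  define k3 where "k3 = (\<lambda>x. h3 x + (Re (D 0 0 x) - Re (D 1 1 x)) * (1 / 2))"
  show thesis
  proof (rule that[of k1 k2 k3])
    show "continuous_map M euclideanreal k1" "continuous_map M euclideanreal k2"
      "continuous_map M euclideanreal k3"
      unfolding k1_def k2_def k3_def by (intro continuous_intros h contRe contIm; simp)+
    fix x assume x: "x \<in> topspace M"
    have b: "\<bar>Re (D i j x)\<bar> < 4 * \<delta>" "\<bar>Im (D i j x)\<bar> < 4 * \<delta>" if "i < 2" "j < 2" for i j
      using D[OF x that] abs_Re_le_cmod[of "D i j x"] abs_Im_le_cmod[of "D i j x"] by linarith+
    have b01: "\<bar>Re (D 0 1 x)\<bar> < 4 * \<delta>" "\<bar>Im (D 0 1 x)\<bar> < 4 * \<delta>"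
      and b00: "\<bar>Re (D 0 0 x)\<bar> < 4 * \<delta>" and b11: "\<bar>Re (D 1 1 x)\<bar> < 4 * \<delta>"
      by (rule b; simp)+
    have "\<bar>k1 x - h1 x\<bar> < \<epsilon>" "\<bar>k2 x - h2 x\<bar> < \<epsilon>"
      using b01 \<epsilon> by (simp_all add: k1_def k2_def \<delta>_def)
    moreover have "\<bar>k3 x - h3 x\<bar> < \<epsilon>"
      using abs_triangle_ineq4[of "Re (D 0 0 x)" "Re (D 1 1 x)"] b00 b11 \<epsilon>
      by (simp add: k3_def \<delta>_def)
    ultimately show "\<bar>k1 x - h1 x\<bar> < \<epsilon> \<and> \<bar>k2 x - h2 x\<bar> < \<epsilon> \<and> \<bar>k3 x - h3 x\<bar> < \<epsilon>"
      by blast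
    show "k1 x \<noteq> 0 \<or> k2 x \<noteq> 0 \<or> k3 x \<noteq> 0"
    proof (rule ccontr)
      assume "\<not> ?thesis"
      then have k: "k1 x = 0" "k2 x = 0" "k3 x = 0" by auto
      \<comment> \<open>If all coordinates vanish, the Hermitian matrix \<open>G\<close> is scalar,
        so conjugation by \<open>u\<close> gives upper right entry 0; by the construction of
        \<open>D\<close> that entry is \<open>\<delta>\<close>.\<close>
      define G where "G = (\<lambda>i j. H i j x + D i j x)"
      have Gh: "G j i = cnj (G i j)" for i j
        by (simp add: G_def herm[of j i] D_def algebra_simps)
      have G01: "G 0 1 = 0"
        using k(1,2) by (simp add: G_def H_def complex_eq_iff k1_def k2_def)
      then have G10: "G 1 0 = 0" using Gh[of 1 0] by simp
      have "Im (G 0 0) = 0" "Im (G 1 1) = 0"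
        using Gh[of 0 0] Gh[of 1 1] by (auto simp: complex_eq_iff)
      moreover have "Re (G 0 0) = Re (G 1 1)"
        using k(3) by (simp add: G_def H_def k3_def field_simps)
      ultimately have G11: "G 1 1 = G 0 0" by (simp add: complex_eq_iff)
      let ?a = "u 0 0 x" and ?b = "u 0 1 x" and ?c = "u 1 0 x" and ?d = "u 1 1 x"
      have s2: "(\<Sum>k<2. f k) = f 0 + f 1" for f :: "nat \<Rightarrow> complex"
        by (simp add: eval_nat_numeral)
      have r: "?a * cnj ?a + ?b * cnj ?b = 1" "?c * cnj ?c + ?d * cnj ?d = 1"
        "?a * cnj ?c + ?b * cnj ?d = 0"
        using row[OF x, of 0 0] row[OF x, of 1 1] row[OF x, of 0 1] by (simp_all add: s2)
      have "(\<Sum>i<2. \<Sum>j<2. u 0 i x * G i j * cnj (u 1 j x)) =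
          z x + (?a * cnj ?a + ?b * cnj ?b) * e x * (?c * cnj ?c + ?d * cnj ?d) +
           (?a * cnj ?c + ?b * cnj ?d) * cnj (e x) * (?a * cnj ?c + ?b * cnj ?d)"
        unfolding s2 z_def G_def D_def by (simp add: algebra_simps)
      also have "\<dots> = \<delta>" unfolding r by (simp add: e_def)
      finally have "complex_of_real \<delta> = (\<Sum>i<2. \<Sum>j<2. u 0 i x * G i j * cnj (u 1 j x))" ..
      also have "\<dots> = G 0 0 * (?a * cnj ?c + ?b * cnj ?d)"
        unfolding s2 G01 G10 G11 by (simp add: algebra_simps)
      also have "\<dots> = 0" unfolding r by simp
      finally show False using \<delta> by simp
    qed
  qed
qed

section \<open>Shrinking covers until four members have no common point\<close>

text \<open>Once a map to the simplex misses the barycentre, its four coordinates are nowhere all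
  equal. The sets where a coordinate is large relative to the smallest one still cover but have no
  common point.\<close>

lemma approx_diagonal_four_cover:
  fixes U :: "nat \<Rightarrow> 'a set"
  assumes M: "compact_space M" "Hausdorff_space M" and AD: "approx_diagonal M"
    and U: "\<And>i. i < 4 \<Longrightarrow> openin M (U i)" "(\<Union>i<4. U i) = topspace M"
  obtains W :: "nat \<Rightarrow> 'a set"
  where "\<And>i. i < 4 \<Longrightarrow> openin M (W i)" "\<And>i. i < 4 \<Longrightarrow> W i \<subseteq> U i"
    "(\<Union>i<4. W i) = topspace M" "(\<Inter>i<4. W i) = {}"
proof (cases "topspace M = {}")
  case True
  show ?thesis
    by (rule that[of "\<lambda>_. {}"]) (auto simp: True lessThan_empty_iff)
next
  case False
  have cover: "open_cover M (U ` {..<4})"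
    using U by (auto simp: open_cover_def)
  obtain n :: nat and \<phi> :: "nat \<Rightarrow> 'a \<Rightarrow> real" and V :: "nat \<Rightarrow> 'a set"
    where "n \<ge> 2" and V: "\<And>k. k < n \<Longrightarrow> V k \<in> U ` {..<4}"
      and cont\<phi>: "\<And>k. k < n \<Longrightarrow> continuous_map M euclideanreal (\<phi> k)"
      and nonneg: "\<And>k x. k < n \<Longrightarrow> x \<in> topspace M \<Longrightarrow> \<phi> k x \<ge> 0"
      and supp: "\<And>k x. k < n \<Longrightarrow> x \<in> topspace M \<Longrightarrow> x \<notin> V k \<Longrightarrow> \<phi> k x = 0"
      and sum1: "\<And>x. x \<in> topspace M \<Longrightarrow> (\<Sum>k<n. \<phi> k x) = 1"
    by (rule compact_Hausdorff_partition_of_unity[OF M cover False]) (rule that)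
  have "\<forall>k. \<exists>i. k < n \<longrightarrow> i < 4 \<and> V k = U i" using V by blast
  then obtain c where c: "\<And>k. k < n \<Longrightarrow> c k < 4" "\<And>k. k < n \<Longrightarrow> V k = U (c k)"
    by metis
  \<comment> \<open>Several \<open>\<phi> k\<close> may belong to the same \<open>U i\<close>; they
    are added up according to the assignment \<open>c\<close>.\<close>
  define \<psi> where "\<psi> = (\<lambda>i x. \<Sum>k<n. if c k = i then \<phi> k x else 0)"
  have cont\<psi>: "continuous_map M euclideanreal (\<psi> i)" for i
    unfolding \<psi>_def
  proof (intro continuous_map_sum)
    fix k assume "k \<in> {..<n}"
    then show "continuous_map M euclideanreal (\<lambda>x. if c k = i then \<phi> k x else 0)"
      using cont\<phi> by (cases "c k = i") auto
  qed simp
  have \<psi>0: "\<psi> i x \<ge> 0" if "x \<in> topspace M" for i x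
    unfolding \<psi>_def using nonneg that by (intro sum_nonneg) auto
  have \<psi>U: "\<psi> i x = 0" if "x \<in> topspace M" "x \<notin> U i" for i x
    unfolding \<psi>_def using supp that c by (intro sum.neutral) auto
  have "(\<Sum>i<4. \<psi> i x) = 1" if x: "x \<in> topspace M" for x
  proof -
    have "(\<Sum>i<4. \<psi> i x) = (\<Sum>k<n. \<Sum>i<4. if c k = i then \<phi> k x else 0)"
      unfolding \<psi>_def by (rule sum.swap)
    also have "\<dots> = (\<Sum>k<n. \<phi> k x)"
      using c by (intro sum.cong) auto
    finally show ?thesis using sum1[OF x] by simp
  qed
  then have \<psi>1: "\<psi> 0 x + \<psi> 1 x + \<psi> 2 x + \<psi> 3 x = 1" if "x \<in> topspace M" for x
    using that by (simp add: eval_nat_numeral)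
  \<comment> \<open>The coordinates \<open>g\<close> below send these three targets to the numbers
    \<open>\<psi> i x - 1/4\<close>. Each \<open>g i\<close> is a signed sum of \<open>k1\<close>,
    \<open>k2\<close>, \<open>k3\<close>, so errors below 1/36 add up to less than 1/12.\<close>
  obtain k1 k2 k3 :: "'a \<Rightarrow> real"
    where k: "continuous_map M euclideanreal k1" "continuous_map M euclideanreal k2"
      "continuous_map M euclideanreal k3"
    and near: "\<And>x. x \<in> topspace M \<Longrightarrow> \<bar>k1 x - ((\<psi> 0 x + \<psi> 1 x) * (1/2) - 1/4)\<bar> < 1/36 \<and>
        \<bar>k2 x - ((\<psi> 0 x + \<psi> 2 x) * (1/2) - 1/4)\<bar> < 1/36 \<and>
        \<bar>k3 x - ((\<psi> 0 x + \<psi> 3 x) * (1/2) - 1/4)\<bar> < 1/36"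
    and nz: "\<And>x. x \<in> topspace M \<Longrightarrow> k1 x \<noteq> 0 \<or> k2 x \<noteq> 0 \<or> k3 x \<noteq> 0"
  proof (rule approx_diagonal_nonvanishing[OF M(1) AD])
    show "(0::real) < 1/36" by simp
    show "continuous_map M euclideanreal (\<lambda>x. (\<psi> 0 x + \<psi> 1 x) * (1/2) - 1/4)"
      "continuous_map M euclideanreal (\<lambda>x. (\<psi> 0 x + \<psi> 2 x) * (1/2) - 1/4)"
      "continuous_map M euclideanreal (\<lambda>x. (\<psi> 0 x + \<psi> 3 x) * (1/2) - 1/4)"
      by (intro continuous_intros cont\<psi>)+
  qed (rule that)
  \<comment> \<open>In these four coordinates of sum 0 on \<open>\<real>\<^sup>3\<close> the function \<open>k\<close> approximates \<open>\<psi> i - 1/4\<close>, the partition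
    of unity seen from the barycentre of the simplex.\<close>
  define g where "g = (\<lambda>(i::nat) x. if i = 0 then k1 x + k2 x + k3 x else if i = 1 then k1 x - k2 x - k3 x
    else if i = 2 then k2 x - k1 x - k3 x else k3 x - k1 x - k2 x)"
  have contg: "continuous_map M euclideanreal (g i)" for i
  proof -
    consider "i = 0" | "i = 1" | "i = 2" | "i \<notin> {0, 1, 2}" by blast
    then show ?thesis
      by cases (simp_all add: g_def, (intro continuous_intros k)+)
  qed
  have four: "i = 0 \<or> i = 1 \<or> i = 2 \<or> i = 3" if "i < 4" for i :: nat
    using that by linarith
  have g: "\<bar>g i x - (\<psi> i x - 1/4)\<bar> < 1/12" if "x \<in> topspace M" "i < 4" for i x
  proof -
    note x = that(1)
    have n: "k1 x - ((\<psi> 0 x + \<psi> 1 x) * (1/2) - 1/4) < 1/36" "- (k1 x - ((\<psi> 0 x + \<psi> 1 x) * (1/2) - 1/4)) < 1/36"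
      "k2 x - ((\<psi> 0 x + \<psi> 2 x) * (1/2) - 1/4) < 1/36" "- (k2 x - ((\<psi> 0 x + \<psi> 2 x) * (1/2) - 1/4)) < 1/36"
      "k3 x - ((\<psi> 0 x + \<psi> 3 x) * (1/2) - 1/4) < 1/36" "- (k3 x - ((\<psi> 0 x + \<psi> 3 x) * (1/2) - 1/4)) < 1/36"
      using near[OF x] unfolding abs_less_iff by blast+
    have gs: "g 0 x = k1 x + k2 x + k3 x" "g 1 x = k1 x - k2 x - k3 x"
      "g 2 x = k2 x - k1 x - k3 x" "g 3 x = k3 x - k1 x - k2 x"
      by (simp_all add: g_def)
    have "\<bar>g 0 x - (\<psi> 0 x - 1/4)\<bar> < 1/12 \<and> \<bar>g 1 x - (\<psi> 1 x - 1/4)\<bar> < 1/12 \<and>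
      \<bar>g 2 x - (\<psi> 2 x - 1/4)\<bar> < 1/12 \<and> \<bar>g 3 x - (\<psi> 3 x - 1/4)\<bar> < 1/12"
      unfolding abs_less_iff gs by (intro conjI; use n \<psi>1[OF x] in argo)
    then show ?thesis
      using four[OF that(2)] by blast
  qed
  have gsum: "g 0 x + g 1 x + g 2 x + g 3 x = 0" for x
    by (simp add: g_def)
  have gnz: "\<exists>i<4. g i x \<noteq> 0" if "x \<in> topspace M" for x
  proof (rule ccontr)
    assume "\<not> ?thesis"
    then have "g 0 x = 0" "g 1 x = 0" "g 2 x = 0" "g 3 x = 0" by auto
    then have "k1 x = 0" "k2 x = 0" "k3 x = 0" by (simp_all add: g_def)
    then show False using nz[OF that] by simp
  qed
  \<comment> \<open>A point lies in \<open>W i\<close> iff twice \<open>g i\<close> exceeds the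
    minimum of the four values there. This holds wherever \<open>g i\<close> is positive, so the
    sets cover, the values having sum 0 without all being 0. At the index of the minimum it forces
    all values to be positive, so no point lies in all four sets.\<close>
  define W where "W = (\<lambda>i. \<Union>j<4. {x \<in> topspace M. g j x - 2 * g i x < 0})"
  show ?thesis
  proof (rule that[of W])
    fix i :: nat assume i: "i < 4"
    have "continuous_map M euclideanreal (\<lambda>x. g j x - 2 * g i x)" for j
      by (intro continuous_intros contg)
    then have "openin M {x \<in> topspace M. g j x - 2 * g i x < 0}" for j
      unfolding continuous_map_upper_lower_semicontinuous_lt by blast
    then show "openin M (W i)"
      unfolding W_def by blast
    show "W i \<subseteq> U i"
    proof
      fix x assume "x \<in> W i"
      then obtain j where j: "j < 4" "g j x < 2 * g i x" and x: "x \<in> topspace M"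
        by (auto simp: W_def)
      show "x \<in> U i"
      proof (rule ccontr)
        assume "x \<notin> U i"
        then have "\<psi> i x = 0" by (rule \<psi>U[OF x])
        \<comment> \<open>Now \<open>g i x\<close> is below -1/6 while every \<open>g j x\<close> is
          above -1/3. The tolerance 1/12 is the largest for which these bounds exclude
          \<open>g j x < 2 * g i x\<close>.\<close>
        then have "g i x - (0 - 1/4) < 1/12"
          using g[OF x i] by (simp only: abs_less_iff)
        moreover have "- (g j x - (\<psi> j x - 1/4)) < 1/12"
          using g[OF x j(1)] by (simp only: abs_less_iff)
        then have "- (g j x + 1/4) < 1/12" using \<psi>0[OF x, of j] by linarith
        ultimately show False using j(2) by simp
      qed
    qed
  next
    show "(\<Union>i<4. W i) = topspace M"
    proof (intro equalityI subsetI)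
      fix x assume x: "x \<in> topspace M"
      show "x \<in> (\<Union>i<4. W i)"
      proof (rule ccontr)
        assume *: "x \<notin> (\<Union>i<4. W i)"
        have le: "g i x \<le> 0" if i: "i < 4" for i
        proof -
          have "\<not> g i x - 2 * g i x < 0" using i * x unfolding W_def by blast
          then show ?thesis by simp
        qed
        then have "g i x = 0" if "i < 4" for i
        proof -
          have "g 0 x \<le> 0" "g 1 x \<le> 0" "g 2 x \<le> 0" "g 3 x \<le> 0" by (rule le; simp)+
          then have "g 0 x = 0" "g 1 x = 0" "g 2 x = 0" "g 3 x = 0" using gsum[of x] by linarith+
          then show ?thesis using four[OF that] by blast
        qed
        then show False using gnz[OF x] by blast
      qed
    qed (auto simp: W_def)
    show "(\<Inter>i<4. W i) = {}"
    proof (rule ccontr)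
      assume "\<not> ?thesis"
      then obtain x where x: "\<And>i. i < 4 \<Longrightarrow> x \<in> W i" by auto
      obtain i :: nat where i: "i < 4" "\<And>j. j < 4 \<Longrightarrow> g i x \<le> g j x"
        using ex_min_if_finite[of "(\<lambda>i. g i x) ` {..<4::nat}"] by (auto simp: not_less lessThan_empty_iff)
      obtain j where "j < 4" "g j x < 2 * g i x" using x[OF i(1)] by (auto simp: W_def)
      with i(2)[of j] have "g i x > 0" by simp
      then show False using i(2)[of 0] i(2)[of 1] i(2)[of 2] i(2)[of 3] gsum[of x] by simp
    qed
  qed
qed

text \<open>Given four members of a cover, merging the fourth with all the remaining ones reduces to a
  cover by four sets.\<close>

lemma approx_diagonal_shrink_quadruple:
  fixes U :: "'i \<Rightarrow> 'a set"
  assumes M: "compact_space M" "Hausdorff_space M" and AD: "approx_diagonal M"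
    and U: "\<And>i. i \<in> I \<Longrightarrow> openin M (U i)" "(\<Union>i\<in>I. U i) = topspace M"
    and S: "S \<subseteq> I" "card S = 4"
  obtains W :: "'i \<Rightarrow> 'a set"
  where "\<And>i. i \<in> I \<Longrightarrow> openin M (W i)" "\<And>i. i \<in> I \<Longrightarrow> W i \<subseteq> U i"
    "(\<Union>i\<in>I. W i) = topspace M" "(\<Inter>i\<in>S. W i) = {}"
proof -
  obtain a b c d where S_eq: "S = {a, b, c, d}" and ne: "distinct [a, b, c, d]"
  proof -
    have "card S = Suc 3" using S(2) by simp
    then obtain a T where T: "S = insert a T" "a \<notin> T" "card T = 3"
      unfolding card_Suc_eq by blast
    then obtain b c d where "T = {b, c, d}" "b \<noteq> c" "c \<noteq> d" "b \<noteq> d"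
      unfolding card_3_iff by blast
    then show ?thesis using T by (intro that[of a b c d]) auto
  qed
  have abcd: "a \<in> I" "b \<in> I" "c \<in> I" "d \<in> I" using S(1) S_eq by auto
  define R where "R = (\<Union>j\<in>I - {a, b, c}. U j)"
  define V where "V = (\<lambda>i::nat. if i = 0 then U a else if i = 1 then U b else if i = 2 then U c else R)"
  have R: "openin M R" unfolding R_def using U(1) by blast
  have l4: "{..<4::nat} = {0, 1, 2, 3}" by auto
  have "openin M (V i)" for i
    unfolding V_def using U(1) R abcd by simp
  moreover have "(\<Union>i<4. V i) = topspace M"
    unfolding U(2)[symmetric] l4 V_def R_def using abcd by auto
  ultimately obtain W where W: "\<And>i. i < 4 \<Longrightarrow> openin M (W i)" "\<And>i. i < 4 \<Longrightarrow> W i \<subseteq> V i"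
    "(\<Union>i<4. W i) = topspace M" "(\<Inter>i<4. W i) = {}"
    by (rule approx_diagonal_four_cover[OF M AD]) (rule that)
  have WV: "W 0 \<subseteq> U a" "W 1 \<subseteq> U b" "W 2 \<subseteq> U c" "W 3 \<subseteq> R"
    using W(2)[of 0] W(2)[of 1] W(2)[of 2] W(2)[of 3] by (simp_all add: V_def)
  have Wo: "openin M (W 0)" "openin M (W 1)" "openin M (W 2)" "openin M (W 3)"
    using W(1) by simp_all
  \<comment> \<open>All members besides \<open>a\<close>, \<open>b\<close>, \<open>c\<close> are cut
    down to \<open>W 3\<close>; since \<open>W 3 \<subseteq> R\<close>, the pieces still cover
    \<open>W 3\<close>.\<close>
  define Q where "Q = (\<lambda>i. if i = a then W 0 else if i = b then W 1 else if i = c then W 2 else U i \<inter> W 3)"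
  have Qabc: "Q a = W 0" "Q b = W 1" "Q c = W 2" and Qj: "\<And>j. j \<notin> {a, b, c} \<Longrightarrow> Q j = U j \<inter> W 3"
    using ne by (auto simp: Q_def)
  show ?thesis
  proof (rule that[of Q])
    show "openin M (Q i)" if "i \<in> I" for i
      unfolding Q_def using Wo U(1)[OF that] by auto
    show QU: "Q i \<subseteq> U i" if "i \<in> I" for i
      unfolding Q_def using WV by auto
    show "(\<Union>i\<in>I. Q i) = topspace M"
    proof
      show "(\<Union>i\<in>I. Q i) \<subseteq> topspace M" using QU U(2) by blast
      show "topspace M \<subseteq> (\<Union>i\<in>I. Q i)"
      proof
        fix x assume "x \<in> topspace M"
        then have "x \<in> W 0 \<or> x \<in> W 1 \<or> x \<in> W 2 \<or> x \<in> W 3"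
          unfolding W(3)[symmetric] l4 by auto
        moreover have "x \<in> (\<Union>i\<in>I. Q i)" if x: "x \<in> W 3"
        proof -
          from x WV(4) obtain j where "j \<in> I - {a, b, c}" "x \<in> U j" by (auto simp: R_def)
          with x Qj[of j] show ?thesis by auto
        qed
        ultimately show "x \<in> (\<Union>i\<in>I. Q i)" using Qabc abcd by auto
      qed
    qed
    have "Q d = U d \<inter> W 3" using ne by (intro Qj) auto
    then show "(\<Inter>i\<in>S. Q i) = {}"
      using W(4) unfolding S_eq l4 by (auto simp: Qabc)
  qed
qed

text \<open>The quadruples are treated one at a time: further shrinking preserves empty
  intersections, and the fixed index set keeps the other quadruples meaningful.\<close>

lemma approx_diagonal_shrink_quadruples:
  fixes U :: "'i \<Rightarrow> 'a set"
  assumes M: "compact_space M" "Hausdorff_space M" and AD: "approx_diagonal M"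
    and U: "\<And>i. i \<in> I \<Longrightarrow> openin M (U i)" "(\<Union>i\<in>I. U i) = topspace M"
    and \<S>: "finite \<S>" "\<And>S. S \<in> \<S> \<Longrightarrow> S \<subseteq> I \<and> card S = 4"
  shows "\<exists>W. (\<forall>i\<in>I. openin M (W i) \<and> W i \<subseteq> U i) \<and> (\<Union>i\<in>I. W i) = topspace M \<and>
    (\<forall>S\<in>\<S>. (\<Inter>i\<in>S. W i) = {})"
  using \<S>
proof (induction \<S>)
  case empty
  show ?case using U by (intro exI[of _ U]) auto
next
  case (insert S \<S>)
  have "\<exists>W. (\<forall>i\<in>I. openin M (W i) \<and> W i \<subseteq> U i) \<and> (\<Union>i\<in>I. W i) = topspace M \<and>
      (\<forall>S\<in>\<S>. (\<Inter>i\<in>S. W i) = {})"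
    by (rule insert.IH) (use insert.prems in blast)
  then obtain W where W0: "\<forall>i\<in>I. openin M (W i) \<and> W i \<subseteq> U i" "(\<Union>i\<in>I. W i) = topspace M"
      "\<forall>S\<in>\<S>. (\<Inter>i\<in>S. W i) = {}"
    by blast
  have W: "\<And>i. i \<in> I \<Longrightarrow> openin M (W i)" "\<And>i. i \<in> I \<Longrightarrow> W i \<subseteq> U i"
    "(\<Union>i\<in>I. W i) = topspace M" "\<And>S. S \<in> \<S> \<Longrightarrow> (\<Inter>i\<in>S. W i) = {}"
    using W0 by simp_all
  have S: "S \<subseteq> I" "card S = 4" using insert.prems by auto
  obtain Q where Q: "\<And>i. i \<in> I \<Longrightarrow> openin M (Q i)" "\<And>i. i \<in> I \<Longrightarrow> Q i \<subseteq> W i"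
    "(\<Union>i\<in>I. Q i) = topspace M" "(\<Inter>i\<in>S. Q i) = {}"
    by (rule approx_diagonal_shrink_quadruple[OF M AD W(1,3) S], assumption) (rule that)
  have "(\<Inter>i\<in>T. Q i) = {}" if T: "T \<in> \<S>" for T
  proof -
    have "T \<subseteq> I" using insert.prems T by auto
    then have "(\<Inter>i\<in>T. Q i) \<subseteq> (\<Inter>i\<in>T. W i)" using Q(2) by blast
    then show ?thesis using W(4)[OF T] by simp
  qed
  then show ?case
    using Q W(2) by (intro exI[of _ Q]) blast
qed

text \<open>The cover is indexed by itself and shrunk for all of its 4-element subsets at
  once.\<close>

theorem approx_diagonal_covering_dim_le:
  assumes M: "compact_space M" "Hausdorff_space M" and AD: "approx_diagonal M"
  shows "covering_dim_le M 2"
  unfolding covering_dim_le_def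
proof (intro allI impI)
  fix \<U> assume U: "finite \<U> \<and> open_cover M \<U>"
  have "\<exists>W. (\<forall>A\<in>\<U>. openin M (W A) \<and> W A \<subseteq> A) \<and> (\<Union>A\<in>\<U>. W A) = topspace M \<and>
    (\<forall>S\<in>{S. S \<subseteq> \<U> \<and> card S = 4}. (\<Inter>A\<in>S. W A) = {})"
    using U by (intro approx_diagonal_shrink_quadruples[OF M AD, where U = "\<lambda>A. A"])
      (auto simp: open_cover_def)
  then obtain W where W0: "\<forall>A\<in>\<U>. openin M (W A) \<and> W A \<subseteq> A" "(\<Union>A\<in>\<U>. W A) = topspace M"
    "\<forall>S\<in>{S. S \<subseteq> \<U> \<and> card S = 4}. (\<Inter>A\<in>S. W A) = {}"
    by (elim exE conjE) (rule that)
  note W = bspec[OF W0(1)] W0(2)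
  have quad: "(\<Inter>A\<in>S. W A) = {}" if "S \<subseteq> \<U>" "card S = 4" for S
    by (rule bspec[OF W0(3)]) (use that in simp)
  show "\<exists>\<V>. finite \<V> \<and> open_cover M \<V> \<and> (\<forall>V\<in>\<V>. \<exists>U\<in>\<U>. V \<subseteq> U) \<and>
            (\<forall>x\<in>topspace M. card {V \<in> \<V>. x \<in> V} \<le> 2 + 1)"
  proof (intro exI[of _ "W ` \<U>"] conjI ballI)
    show "finite (W ` \<U>)" "open_cover M (W ` \<U>)"
      using U W by (auto simp: open_cover_def)
    show "\<exists>U\<in>\<U>. V \<subseteq> U" if "V \<in> W ` \<U>" for V
      using that W(1) by blast
    fix x assume "x \<in> topspace M"
    \<comment> \<open>Indices are counted instead of sets: \<open>W\<close> may send different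
      members to one set, which only lowers the order.\<close>
    let ?J = "{A \<in> \<U>. x \<in> W A}"
    have "\<not> card ?J \<ge> 4"
    proof
      assume "card ?J \<ge> 4"
      then obtain S where "S \<subseteq> ?J" "card S = 4" by (metis obtain_subset_with_card_n)
      then show False using quad[of S] by blast
    qed
    moreover have "{V \<in> W ` \<U>. x \<in> V} = W ` ?J" by blast
    moreover have "card (W ` ?J) \<le> card ?J" using U by (intro card_image_le) simp
    ultimately show "card {V \<in> W ` \<U>. x \<in> V} \<le> 2 + 1" by simp
  qed
qed

section \<open>Second cohomology\<close>

text \<open>The \<open>a m\<close> stand for the squared moduli of the coordinates of a unit vector,
  the diagonal of a rank one projection. Some \<open>a m\<close> is at least \<open>1 / n\<close>;
  small products then make each other one at most \<open>1 / (4 * n)\<close>, so these sum to at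
  most 1/4.\<close>

lemma near_diagonal_rank_one:
  fixes a :: "nat \<Rightarrow> real"
  assumes n: "n \<ge> 1" and nonneg: "\<And>m. m < n \<Longrightarrow> a m \<ge> 0" and sum1: "(\<Sum>m<n. a m) = 1"
    and small: "\<And>m l. m < n \<Longrightarrow> l < n \<Longrightarrow> m \<noteq> l \<Longrightarrow> a m * a l \<le> 1 / (4 * (real n)\<^sup>2)"
  obtains m where "m < n" "a m > 1 / 2"
proof -
  obtain m where m: "m < n" "a m \<ge> 1 / real n"
  proof (rule ccontr)
    assume "\<not> thesis"
    then have "\<And>m. m < n \<Longrightarrow> a m < 1 / real n" using that by (meson not_le)
    then have "(\<Sum>m<n. a m) < (\<Sum>m<n. 1 / real n)"
      using n by (intro sum_strict_mono) (auto simp: lessThan_empty_iff)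
    then show False using sum1 n by simp
  qed
  have "a l \<le> 1 / (4 * real n)" if l: "l < n" "l \<noteq> m" for l
  proof -
    have "1 / real n * a l \<le> a m * a l"
      using m(2) nonneg[OF l(1)] by (intro mult_right_mono)
    also have "\<dots> \<le> 1 / (4 * (real n)\<^sup>2)" using small[of m l] m l by auto
    finally show ?thesis using n by (simp add: field_simps power2_eq_square)
  qed
  then have "(\<Sum>l\<in>{..<n} - {m}. a l) \<le> real (card ({..<n} - {m})) * (1 / (4 * real n))"
    by (intro sum_bounded_above) auto
  also have "\<dots> \<le> real n * (1 / (4 * real n))"
    by (intro mult_right_mono) (auto simp: card_Diff_singleton_if)
  also have "\<dots> = 1 / 4" using n by simp
  finally have "(\<Sum>l\<in>{..<n} - {m}. a l) \<le> 1 / 4" .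
  moreover have "(\<Sum>l<n. a l) = a m + (\<Sum>l\<in>{..<n} - {m}. a l)"
    using m(1) by (simp add: sum.remove)
  ultimately show ?thesis
    using that[OF m(1)] sum1 by simp
qed

text \<open>\<open>y m i\<close> is row \<open>m\<close> of the unitary, as a functional on the
  bundle, evaluated on the local unit frame over \<open>V i\<close>; hence the transition rule. The
  off-diagonal entries of the conjugated projection are the products of one coordinate with the
  conjugate of another, so one coordinate dominates.\<close>

lemma approx_diagonal_line_bundle:
  fixes \<phi> :: "nat \<Rightarrow> 'a \<Rightarrow> real" and g :: "nat \<Rightarrow> nat \<Rightarrow> 'a \<Rightarrow> complex" and V :: "nat \<Rightarrow> 'a set"
  assumes M: "compact_space M" and AD: "approx_diagonal M" and n: "n \<ge> 2"
    and cont\<phi>: "\<And>k. k < n \<Longrightarrow> continuous_map M euclideanreal (\<phi> k)"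
    and nonneg: "\<And>k x. k < n \<Longrightarrow> x \<in> topspace M \<Longrightarrow> \<phi> k x \<ge> 0"
    and supp: "\<And>k x. k < n \<Longrightarrow> x \<in> topspace M \<Longrightarrow> x \<notin> V k \<Longrightarrow> \<phi> k x = 0"
    and sum1: "\<And>x. x \<in> topspace M \<Longrightarrow> (\<Sum>k<n. \<phi> k x) = 1"
    and contg: "\<And>i j. i < n \<Longrightarrow> j < n \<Longrightarrow> continuous_map M euclidean (g i j)"
    and gnorm: "\<And>i j x. i < n \<Longrightarrow> j < n \<Longrightarrow> cmod (g i j x) = 1"
    and gg: "\<And>i j l x. i < n \<Longrightarrow> j < n \<Longrightarrow> l < n \<Longrightarrow> x \<in> topspace M \<Longrightarrow> x \<in> V i \<Longrightarrow> x \<in> V j \<Longrightarrow>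
        x \<in> V l \<Longrightarrow> g i j x * g j l x = g i l x"
  obtains y :: "nat \<Rightarrow> nat \<Rightarrow> 'a \<Rightarrow> complex"
  where "\<And>m i. m < n \<Longrightarrow> i < n \<Longrightarrow> continuous_map M euclidean (y m i)"
    and "\<And>m i j x. m < n \<Longrightarrow> i < n \<Longrightarrow> j < n \<Longrightarrow> x \<in> topspace M \<Longrightarrow> x \<in> V i \<Longrightarrow> x \<in> V j \<Longrightarrow>
        y m j x = y m i x * g i j x"
    and "\<And>i x. i < n \<Longrightarrow> x \<in> topspace M \<Longrightarrow> x \<in> V i \<Longrightarrow> (\<Sum>m<n. (cmod (y m i x))\<^sup>2) = 1"
    and "\<And>i x. i < n \<Longrightarrow> x \<in> topspace M \<Longrightarrow> x \<in> V i \<Longrightarrow> \<exists>m<n. (cmod (y m i x))\<^sup>2 > 1 / 2"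
proof -
  \<comment> \<open>\<open>P\<close> is the rank one projection onto the line bundle with transition functions \<open>g\<close>; over \<open>V i\<close>
    its range is spanned by the unit vector \<open>w i\<close>.\<close>
  define w where "w = (\<lambda>i k x. complex_of_real (sqrt (\<phi> k x)) * g k i x)"
  define P where "P = (\<lambda>k l x. complex_of_real (sqrt (\<phi> k x)) * complex_of_real (sqrt (\<phi> l x)) * g k l x)"
  have contsq: "continuous_map M euclidean (\<lambda>x. complex_of_real (sqrt (\<phi> k x)))" if "k < n" for k
    by (rule continuous_map_isCont_compose[OF cont\<phi>[OF that], where g = "\<lambda>t. complex_of_real (sqrt t)"])
      (intro continuous_intros)
  have contP: "continuous_map M euclidean (P k l)" if "k < n" "l < n" for k l
    unfolding P_def using that by (intro continuous_map_mult_complex contsq contg)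
  have contw: "continuous_map M euclidean (w i k)" if "k < n" "i < n" for k i
    unfolding w_def using that by (intro continuous_map_mult_complex contsq contg)
  have gii: "g i i x = 1" if "i < n" "x \<in> topspace M" "x \<in> V i" for i x
  proof -
    have "g i i x * g i i x = g i i x" using gg[of i i i x] that by simp
    moreover have "g i i x \<noteq> 0" using gnorm[OF that(1,1), of x] by auto
    ultimately show ?thesis by simp
  qed
  have gcnj: "g j i x = cnj (g i j x)" if "i < n" "j < n" "x \<in> topspace M" "x \<in> V i" "x \<in> V j" for i j x
  proof -
    have "g i j x * g j i x = 1" using gg[of i j i x] gii[of i x] that by simp
    moreover have "g i j x * cnj (g i j x) = 1"
      using gnorm[OF that(1,2), of x] by (simp flip: complex_norm_square)
    moreover have "g i j x \<noteq> 0" using gnorm[OF that(1,2), of x] by auto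
    ultimately show ?thesis by (metis mult_cancel_left)
  qed
  \<comment> \<open>The cocycle identity is available only on overlaps; off \<open>V k\<close> or
    \<open>V l\<close> both sides vanish with the weights.\<close>
  have Pw: "P k l x = w i k x * cnj (w i l x)"
    if "k < n" "l < n" "i < n" "x \<in> topspace M" "x \<in> V i" for k l i x
  proof (cases "x \<in> V k \<and> x \<in> V l")
    case True
    then have "g k l x = g k i x * cnj (g l i x)"
      using gg[of k i l x] gcnj[of l i x] that by simp
    then show ?thesis by (simp add: P_def w_def)
  next
    case False
    then have "\<phi> k x = 0 \<or> \<phi> l x = 0" using supp that by blast
    then show ?thesis by (auto simp: P_def w_def)
  qed
  have Pherm: "P l k x = cnj (P k l x)" if "x \<in> topspace M" "k < n" "l < n" for x k l
  proof (cases "x \<in> V k \<and> x \<in> V l")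
    case True
    then show ?thesis using gcnj[of k l x] that by (simp add: P_def)
  next
    case False
    then have "\<phi> k x = 0 \<or> \<phi> l x = 0" using supp that by blast
    then show ?thesis by (auto simp: P_def)
  qed
  \<comment> \<open>Squaring this tolerance gives the bound required by
    \<open>near_diagonal_rank_one\<close>.\<close>
  have \<epsilon>: "1 / (2 * real n) > 0" using n by simp
  obtain u :: "nat \<Rightarrow> nat \<Rightarrow> 'a \<Rightarrow> complex"
    where contu: "\<And>i j. i < n \<Longrightarrow> j < n \<Longrightarrow> continuous_map M euclidean (u i j)"
    and "\<And>x i j. x \<in> topspace M \<Longrightarrow> i < n \<Longrightarrow> j < n \<Longrightarrow>
          (\<Sum>k<n. u i k x * cnj (u j k x)) = (if i = j then 1 else 0)"
    and col: "\<And>x i j. x \<in> topspace M \<Longrightarrow> i < n \<Longrightarrow> j < n \<Longrightarrow>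
          (\<Sum>k<n. cnj (u k i x) * u k j x) = (if i = j then 1 else 0)"
    and off: "\<And>x i j. x \<in> topspace M \<Longrightarrow> i < n \<Longrightarrow> j < n \<Longrightarrow> i \<noteq> j \<Longrightarrow>
          cmod (\<Sum>k<n. \<Sum>l<n. u i k x * P k l x * cnj (u j l x)) < 1 / (2 * real n)"
    by (rule approx_diagonal_entries[OF M AD n \<epsilon> contP Pherm], assumption+) (rule that)
  define y where "y = (\<lambda>m i x. \<Sum>k<n. u m k x * w i k x)"
  \<comment> \<open>A unitary preserves the norm of \<open>w i\<close>, whose square is the sum of
    the \<open>\<phi> k\<close>.\<close>
  have yy: "(\<Sum>m<n. (cmod (y m i x))\<^sup>2) = 1" if i: "i < n" and x: "x \<in> topspace M" "x \<in> V i" for i x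
  proof -
    have "complex_of_real (\<Sum>m<n. (cmod (y m i x))\<^sup>2) = (\<Sum>m<n. cnj (y m i x) * y m i x)"
      by (simp add: complex_norm_square mult.commute del: of_real_power)
    also have "\<dots> = (\<Sum>m<n. \<Sum>k<n. \<Sum>l<n. (cnj (w i k x) * w i l x) * (cnj (u m k x) * u m l x))"
      unfolding y_def cnj_sum sum_product by (intro sum.cong refl) (simp add: mult_ac)
    also have "\<dots> = (\<Sum>k<n. \<Sum>l<n. \<Sum>m<n. (cnj (w i k x) * w i l x) * (cnj (u m k x) * u m l x))"
      by (rule trans[OF sum.swap], rule sum.cong[OF refl], rule sum.swap)
    also have "\<dots> = (\<Sum>k<n. \<Sum>l<n. (cnj (w i k x) * w i l x) * (if k = l then 1 else 0))"
      using col[OF x(1)] by (intro sum.cong refl) (simp add: sum_distrib_left[symmetric])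
    also have "\<dots> = (\<Sum>k<n. cnj (w i k x) * w i k x)"
      by (intro sum.cong refl) (simp add: if_distrib[of "\<lambda>t. _ * t"] sum.delta cong: if_cong)
    also have "\<dots> = (\<Sum>k<n. complex_of_real ((cmod (w i k x))\<^sup>2))"
      by (simp add: complex_norm_square mult.commute del: of_real_power)
    also have "\<dots> = complex_of_real (\<Sum>k<n. \<phi> k x)"
      using nonneg x(1) gnorm i by (simp add: w_def norm_mult abs_of_nonneg)
    finally have "(\<Sum>m<n. (cmod (y m i x))\<^sup>2) = (\<Sum>k<n. \<phi> k x)"
      by (simp only: of_real_eq_iff)
    then show ?thesis using sum1[OF x(1)] by simp
  qed
  show thesis
  proof (rule that[of y])
    show "continuous_map M euclidean (y m i)" if "m < n" "i < n" for m i
      unfolding y_def using that by (intro continuous_map_sum continuous_map_mult_complex contu contw) auto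
    show "y m j x = y m i x * g i j x"
      if "m < n" and ij: "i < n" "j < n" and x: "x \<in> topspace M" "x \<in> V i" "x \<in> V j" for m i j x
      unfolding y_def sum_distrib_right
    proof (intro sum.cong refl)
      fix k assume "k \<in> {..<n}"
      then have "w j k x = w i k x * g i j x"
        using gg[of k i j x] ij x supp[of k x] by (cases "x \<in> V k") (auto simp: w_def)
      then show "u m k x * w j k x = u m k x * w i k x * g i j x" by simp
    qed
    show "\<exists>m<n. (cmod (y m i x))\<^sup>2 > 1 / 2" if i: "i < n" and x: "x \<in> topspace M" "x \<in> V i" for i x
    proof -
      have "(cmod (y m i x))\<^sup>2 * (cmod (y l i x))\<^sup>2 \<le> 1 / (4 * (real n)\<^sup>2)"
        if ml: "m < n" "l < n" "m \<noteq> l" for m l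
      proof -
        have "(\<Sum>k<n. \<Sum>p<n. u m k x * P k p x * cnj (u l p x)) = y m i x * cnj (y l i x)"
          unfolding y_def cnj_sum sum_product
          by (intro sum.cong refl) (simp add: Pw[OF _ _ i x] mult_ac)
        then have "cmod (y m i x) * cmod (y l i x) < 1 / (2 * real n)"
          using off[OF x(1) ml] by (simp add: norm_mult)
        then have "(cmod (y m i x) * cmod (y l i x))\<^sup>2 \<le> (1 / (2 * real n))\<^sup>2"
          by (intro power_mono) auto
        then show ?thesis by (simp add: power_mult_distrib power_divide)
      qed
      then obtain m where "m < n" "(cmod (y m i x))\<^sup>2 > 1 / 2"
        using n yy[OF i x] by (elim near_diagonal_rank_one[rotated 3]) auto
      then show ?thesis by blast
    qed
  qed (rule yy)
qed

section \<open>From a section of the line bundle to an integral coboundary\<close>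

text \<open>The contracting homotopy of a partition of unity: averaging the cocycle identity on
  \<open>[V k, A, B, C]\<close> with weights \<open>\<phi> k\<close> makes \<open>c\<close> the
  coboundary of a real cochain with function values.\<close>

lemma cocycle_partition_sum:
  assumes c: "c \<in> nerve_cocycles \<U> 2" and V: "\<And>k. k < n \<Longrightarrow> V k \<in> \<U>"
    and supp: "\<And>k. k < n \<Longrightarrow> x \<notin> V k \<Longrightarrow> \<phi> k = (0::real)" and sum1: "(\<Sum>k<n. \<phi> k) = 1"
    and ABC: "A \<in> \<U>" "B \<in> \<U>" "C \<in> \<U>" and x: "x \<in> A" "x \<in> B" "x \<in> C"
  shows "(\<Sum>k<n. \<phi> k * of_int (c [V k, B, C])) - (\<Sum>k<n. \<phi> k * of_int (c [V k, A, C]))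
      + (\<Sum>k<n. \<phi> k * of_int (c [V k, A, B])) = of_int (c [A, B, C])"
proof -
  have "\<phi> k * of_int (c [V k, B, C]) - \<phi> k * of_int (c [V k, A, C]) + \<phi> k * of_int (c [V k, A, B])
      = \<phi> k * of_int (c [A, B, C])" if k: "k < n" for k
  proof (cases "x \<in> V k")
    case True
    then have "[V k, A, B, C] \<in> nerve_simplices \<U> (Suc 2)"
      using V[OF k] ABC x by (auto simp: nerve_simplices_def)
    then have "dlt c [V k, A, B, C] = 0" using c by (simp only: nerve_cocycles_iff)
    then have c_eq: "c [A, B, C] = c [V k, B, C] - c [V k, A, C] + c [V k, A, B]" by simp
    show ?thesis unfolding c_eq of_int_add of_int_diff by (simp add: algebra_simps)
  next
    case False
    then show ?thesis using supp[OF k] by simp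
  qed
  then have "(\<Sum>k<n. \<phi> k * of_int (c [V k, B, C]) - \<phi> k * of_int (c [V k, A, C]) + \<phi> k * of_int (c [V k, A, B]))
      = (\<Sum>k<n. \<phi> k * of_int (c [A, B, C]))"
    by (intro sum.cong) auto
  then show ?thesis
    using sum1 by (simp add: sum.distrib sum_subtractf sum_distrib_right[symmetric])
qed

lemma Arg_less_near_1:
  assumes "\<eta> > 0"
  obtains r where "r > 0" "\<And>z. cmod (z - 1) < r \<Longrightarrow> \<bar>Arg z\<bar> < \<eta>"
proof -
  have "isCont Arg 1" by (intro continuous_at_Arg) (auto simp: complex_nonpos_Reals_iff)
  then obtain r where "r > 0" "\<And>z. dist z 1 < r \<Longrightarrow> dist (Arg z) (Arg 1) < \<eta>"
    using assms unfolding continuous_at_eps_delta by metis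
  then show thesis using that[of r] by (simp add: dist_norm)
qed

lemma cis_2pi_eq_1_imp_int:
  assumes "cis (2 * pi * t) = 1"
  obtains z :: int where "of_int z = t"
proof -
  have "cos (2 * pi * t) = 1" using assms by (simp add: complex_eq_iff)
  then obtain z :: int where "2 * pi * t = of_int z * 2 * pi" by (auto simp: cos_one_2pi_int)
  then have "of_int z = t" by simp
  then show thesis by (rule that)
qed

text \<open>The real cochain \<open>S\<close> has coboundary \<open>c\<close>, and its exponential
  defines a line bundle. Logarithms \<open>\<theta>\<close> of a nonvanishing section correct
  \<open>S\<close> by a coboundary to an integer valued cochain, which therefore also has coboundary
  \<open>c\<close>.\<close>

lemma approx_diagonal_cocycle_refines_to_coboundary:
  assumes M: "compact_space M" "Hausdorff_space M" and AD: "approx_diagonal M"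
    and U: "open_cover M \<U>" and c: "c \<in> nerve_cocycles \<U> 2"
  obtains \<W> p where "open_cover M \<W>" "refinement_map \<W> \<U> p"
    "nerve_pullback \<W> 2 p c \<in> nerve_coboundaries \<W> 2"
proof (cases "topspace M = {}")
  case True
  \<comment> \<open>All members of a cover of the empty space are empty, so the nerve has no
    simplices.\<close>
  have "s \<notin> nerve_simplices \<U> 2" for s
  proof
    assume s: "s \<in> nerve_simplices \<U> 2"
    then have "hd s \<in> set s" by (intro hd_in_set) (auto simp: nerve_simplices_def)
    moreover from this have "hd s = {}" using s U True by (auto simp: nerve_simplices_def open_cover_def)
    ultimately show False using s by (auto simp: nerve_simplices_def)
  qed
  then have "nerve_pullback \<U> 2 id c = (\<lambda>_. 0)" by (simp add: nerve_pullback_def fun_eq_iff)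
  then show ?thesis
    using that[OF U refinement_id] by (simp only: zero_coboundary)
next
  case False
  obtain n :: nat and \<phi> :: "nat \<Rightarrow> 'a \<Rightarrow> real" and V :: "nat \<Rightarrow> 'a set"
    where n: "n \<ge> 2" and V: "\<And>k. k < n \<Longrightarrow> V k \<in> \<U>"
      and cont\<phi>: "\<And>k. k < n \<Longrightarrow> continuous_map M euclideanreal (\<phi> k)"
      and nonneg: "\<And>k x. k < n \<Longrightarrow> x \<in> topspace M \<Longrightarrow> \<phi> k x \<ge> 0"
      and supp: "\<And>k x. k < n \<Longrightarrow> x \<in> topspace M \<Longrightarrow> x \<notin> V k \<Longrightarrow> \<phi> k x = 0"
      and sum1: "\<And>x. x \<in> topspace M \<Longrightarrow> (\<Sum>k<n. \<phi> k x) = 1"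
    by (rule compact_Hausdorff_partition_of_unity[OF M U False]) (rule that)
  have Vo: "openin M (V k)" if "k < n" for k
    using V[OF that] U by (simp add: open_cover_def)
  define S where "S = (\<lambda>i j x. \<Sum>k<n. \<phi> k x * real_of_int (c [V k, V i, V j]))"
  have contS: "continuous_map M euclideanreal (S i j)" for i j
    unfolding S_def by (intro continuous_map_sum continuous_map_real_mult_right cont\<phi>) auto
  have SSS: "S j l x - S i l x + S i j x = real_of_int (c [V i, V j, V l])"
    if "i < n" "j < n" "l < n" "x \<in> topspace M" "x \<in> V i" "x \<in> V j" "x \<in> V l" for i j l x
    unfolding S_def
    by (rule cocycle_partition_sum[OF c]) (use that V supp sum1 in auto)
  \<comment> \<open>\<open>S\<close> is additive only up to the integers \<open>c\<close>, which the
    exponential kills.\<close>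
  define g where "g = (\<lambda>i j x. cis (2 * pi * S i j x))"
  have contg: "continuous_map M euclidean (g i j)" for i j
    unfolding g_def
    by (rule continuous_map_isCont_compose[OF contS, where g = "\<lambda>t. cis (2 * pi * t)"])
      (auto intro!: continuous_intros simp: cis_conv_exp)
  have gg: "g i j x * g j l x = g i l x"
    if "i < n" "j < n" "l < n" "x \<in> topspace M" "x \<in> V i" "x \<in> V j" "x \<in> V l" for i j l x
  proof -
    have "2 * pi * S i j x + 2 * pi * S j l x =
        2 * pi * S i l x + 2 * pi * real_of_int (c [V i, V j, V l])"
      unfolding SSS[OF that, symmetric] by (simp add: algebra_simps)
    then have "g i j x * g j l x = g i l x * cis (2 * pi * real_of_int (c [V i, V j, V l]))"
      by (simp only: g_def cis_mult)
    also have "cis (2 * pi * real_of_int (c [V i, V j, V l])) = 1"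
      by (rule cis_multiple_2pi) simp
    finally show ?thesis by simp
  qed
  have gnorm: "cmod (g i j x) = 1" for i j x by (simp add: g_def)
  obtain y :: "nat \<Rightarrow> nat \<Rightarrow> 'a \<Rightarrow> complex"
    where conty: "\<And>m i. m < n \<Longrightarrow> i < n \<Longrightarrow> continuous_map M euclidean (y m i)"
    and yg: "\<And>m i j x. m < n \<Longrightarrow> i < n \<Longrightarrow> j < n \<Longrightarrow> x \<in> topspace M \<Longrightarrow> x \<in> V i \<Longrightarrow> x \<in> V j \<Longrightarrow>
        y m j x = y m i x * g i j x"
    and ysum: "\<And>i x. i < n \<Longrightarrow> x \<in> topspace M \<Longrightarrow> x \<in> V i \<Longrightarrow> (\<Sum>m<n. (cmod (y m i x))\<^sup>2) = 1"
    and ybig: "\<And>i x. i < n \<Longrightarrow> x \<in> topspace M \<Longrightarrow> x \<in> V i \<Longrightarrow> \<exists>m<n. (cmod (y m i x))\<^sup>2 > 1 / 2"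
    by (rule approx_diagonal_line_bundle[OF M(1) AD n cont\<phi> nonneg supp sum1 contg gnorm gg], assumption+)
      (rule that)
  \<comment> \<open>A common bound for the finitely many values of \<open>c\<close> that occur, with
    1 added to allow division by it.\<close>
  define C where "C = 1 + (\<Sum>i<n. \<Sum>j<n. \<Sum>k<n. \<bar>real_of_int (c [V k, V i, V j])\<bar>)"
  have C0: "C \<ge> 1"
    unfolding C_def by (simp add: sum_nonneg)
  have cC: "\<bar>real_of_int (c [V k, V i, V j])\<bar> \<le> C" if "i < n" "j < n" "k < n" for i j k
  proof -
    have "\<bar>real_of_int (c [V k, V i, V j])\<bar> \<le> (\<Sum>k<n. \<bar>real_of_int (c [V k, V i, V j])\<bar>)"
      using that by (intro member_le_sum) auto
    also have "\<dots> \<le> (\<Sum>j<n. \<Sum>k<n. \<bar>real_of_int (c [V k, V i, V j])\<bar>)"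
      using that by (intro member_le_sum[of j _ "\<lambda>j. \<Sum>k<n. \<bar>real_of_int (c [V k, V i, V j])\<bar>"])
        (auto intro: sum_nonneg)
    also have "\<dots> \<le> (\<Sum>i<n. \<Sum>j<n. \<Sum>k<n. \<bar>real_of_int (c [V k, V i, V j])\<bar>)"
      using that by (intro member_le_sum[of i _ "\<lambda>i. \<Sum>j<n. \<Sum>k<n. \<bar>real_of_int (c [V k, V i, V j])\<bar>"])
        (auto intro: sum_nonneg)
    finally show ?thesis by (simp add: C_def)
  qed
  \<comment> \<open>On a good set a logarithm \<open>\<theta>\<close> of the section and the sums \<open>S i j\<close> vary so little that the integer
    valued functions \<open>N\<close> below are constant on intersections, although these may be disconnected.\<close>
  define good where "good = (\<lambda>W i m \<theta>. openin M W \<and> i < n \<and> m < n \<and> W \<subseteq> V i \<and>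
    (\<forall>x\<in>W. (cmod (y m i x))\<^sup>2 > 1 / 2 \<and> y m i x = complex_of_real (cmod (y m i x)) * cis (2 * pi * \<theta> x)) \<and>
    (\<forall>x\<in>W. \<forall>x'\<in>W. \<bar>\<theta> x - \<theta> x'\<bar> < 1 / 8 \<and> (\<Sum>k<n. \<bar>\<phi> k x - \<phi> k x'\<bar>) \<le> 1 / (8 * C)))"
  have ex_good: "\<exists>W i m \<theta>. x0 \<in> W \<and> good W i m \<theta>" if x0: "x0 \<in> topspace M" for x0
  proof -
    obtain i where i: "i < n" "x0 \<in> V i"
    proof (rule ccontr)
      assume "\<not> thesis"
      then have "\<And>k. k < n \<Longrightarrow> \<phi> k x0 = 0" using that supp x0 by blast
      then have "(\<Sum>k<n. \<phi> k x0) = 0" by (intro sum.neutral) auto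
      then show False using sum1[OF x0] by simp
    qed
    obtain m where m: "m < n" "(cmod (y m i x0))\<^sup>2 > 1 / 2" using ybig[OF i(1) x0 i(2)] by blast
    define w0 where "w0 = y m i x0"
    have w0: "w0 \<noteq> 0" using m by (auto simp: w0_def)
    \<comment> \<open>Two arguments below \<open>pi / 8\<close> in modulus differ by less than
      \<open>pi / 4\<close>, that is by less than 1/8 of a full turn.\<close>
    obtain r where r: "r > 0" "\<And>z. cmod (z - 1) < r \<Longrightarrow> \<bar>Arg z\<bar> < pi / 8"
      by (rule Arg_less_near_1[of "pi / 8"]) auto
    \<comment> \<open>The argument is taken relative to the value at \<open>x0\<close>, hence near 1
      and away from the branch cut, and is measured in full turns.\<close>
    define \<theta> where "\<theta> = (\<lambda>x. (Arg w0 + Arg (y m i x * inverse w0)) / (2 * pi))"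
    define d where "d = (\<lambda>x. \<Sum>k<n. \<bar>\<phi> k x - \<phi> k x0\<bar>)"
    \<comment> \<open>Half of the allowed variation of the \<open>\<phi> k\<close> is granted to the
      distance from \<open>x0\<close>, for the triangle inequality.\<close>
    define W where "W = V i \<inter> {x \<in> topspace M. cmod (y m i x * inverse w0 - 1) < r} \<inter>
      {x \<in> topspace M. 1 / 2 < (cmod (y m i x))\<^sup>2} \<inter> {x \<in> topspace M. d x < 1 / (16 * C)}"
    have c1: "continuous_map M euclideanreal (\<lambda>x. cmod (y m i x * inverse w0 - 1))"
      by (intro continuous_map_norm continuous_map_diff continuous_map_mult_complex conty m i) auto
    have c2: "continuous_map M euclideanreal (\<lambda>x. (cmod (y m i x))\<^sup>2)"
      by (intro continuous_intros conty m i)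
    have c3: "continuous_map M euclideanreal d"
      unfolding d_def by (intro continuous_map_sum continuous_map_real_abs continuous_map_diff cont\<phi>) auto
    have "openin M W"
      unfolding W_def using c1 c2 c3 Vo[OF i(1)]
      unfolding continuous_map_upper_lower_semicontinuous_lt by (intro openin_Int; blast)
    moreover have "x0 \<in> W"
      using i x0 m r w0 C0 by (simp add: W_def d_def w0_def)
    moreover have "y m i x = complex_of_real (cmod (y m i x)) * cis (2 * pi * \<theta> x)" for x
    proof -
      have "y m i x = w0 * (y m i x * inverse w0)" using w0 by simp
      also have "\<dots> = rcis (cmod w0) (Arg w0) * rcis (cmod (y m i x * inverse w0)) (Arg (y m i x * inverse w0))"
        by (simp only: rcis_cmod_Arg)
      also have "\<dots> = rcis (cmod (w0 * (y m i x * inverse w0))) (2 * pi * \<theta> x)"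
        unfolding rcis_mult norm_mult by (simp add: \<theta>_def)
      also have "w0 * (y m i x * inverse w0) = y m i x" using w0 by simp
      finally show ?thesis by (simp add: rcis_def)
    qed
    moreover have "\<bar>\<theta> x - \<theta> x'\<bar> < 1 / 8 \<and> (\<Sum>k<n. \<bar>\<phi> k x - \<phi> k x'\<bar>) \<le> 1 / (8 * C)"
      if x: "x \<in> W" "x' \<in> W" for x x'
    proof
      have "\<bar>Arg (y m i x * inverse w0)\<bar> < pi / 8" "\<bar>Arg (y m i x' * inverse w0)\<bar> < pi / 8"
        using x r(2) by (auto simp: W_def)
      then have "\<bar>Arg (y m i x * inverse w0) - Arg (y m i x' * inverse w0)\<bar> < pi / 4" by linarith
      moreover have "\<theta> x - \<theta> x' = (Arg (y m i x * inverse w0) - Arg (y m i x' * inverse w0)) / (2 * pi)"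
        by (simp add: \<theta>_def diff_divide_distrib[symmetric])
      ultimately show "\<bar>\<theta> x - \<theta> x'\<bar> < 1 / 8"
        by (simp add: abs_divide divide_less_eq)
      have "(\<Sum>k<n. \<bar>\<phi> k x - \<phi> k x'\<bar>) \<le> (\<Sum>k<n. \<bar>\<phi> k x - \<phi> k x0\<bar> + \<bar>\<phi> k x' - \<phi> k x0\<bar>)"
        by (intro sum_mono) linarith
      also have "\<dots> = d x + d x'" by (simp add: d_def sum.distrib)
      also have "\<dots> \<le> 1 / (16 * C) + 1 / (16 * C)" using x by (auto simp: W_def)
      also have "\<dots> = 1 / (8 * C)" using C0 by (simp add: field_simps)
      finally show "(\<Sum>k<n. \<bar>\<phi> k x - \<phi> k x'\<bar>) \<le> 1 / (8 * C)" .
    qed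
    moreover have "W \<subseteq> V i" "\<forall>x\<in>W. (cmod (y m i x))\<^sup>2 > 1 / 2" by (auto simp: W_def)
    ultimately have "x0 \<in> W \<and> good W i m \<theta>"
      unfolding good_def using i(1) m(1) by blast
    then show ?thesis by blast
  qed
  define \<W> where "\<W> = {W. \<exists>i m \<theta>. good W i m \<theta>}"
  have "\<forall>W. \<exists>i m \<theta>. W \<in> \<W> \<longrightarrow> good W i m \<theta>" by (auto simp: \<W>_def)
  then obtain I m \<theta> where good: "\<And>W. W \<in> \<W> \<Longrightarrow> good W (I W) (m W) (\<theta> W)" by metis
  have Wo: "openin M W" and In: "I W < n" and mn: "m W < n" and WV: "W \<subseteq> V (I W)"
    and big: "\<And>x. x \<in> W \<Longrightarrow> (cmod (y (m W) (I W) x))\<^sup>2 > 1 / 2"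
    and polar: "\<And>x. x \<in> W \<Longrightarrow>
      y (m W) (I W) x = complex_of_real (cmod (y (m W) (I W) x)) * cis (2 * pi * \<theta> W x)"
    and \<theta>var: "\<And>x x'. x \<in> W \<Longrightarrow> x' \<in> W \<Longrightarrow> \<bar>\<theta> W x - \<theta> W x'\<bar> < 1 / 8"
    and \<phi>var: "\<And>x x'. x \<in> W \<Longrightarrow> x' \<in> W \<Longrightarrow> (\<Sum>k<n. \<bar>\<phi> k x - \<phi> k x'\<bar>) \<le> 1 / (8 * C)"
    if "W \<in> \<W>" for W
    using good[OF that] unfolding good_def by blast+
  have WM: "x \<in> topspace M" if "W \<in> \<W>" "x \<in> W" for W x
    using openin_subset[OF Wo[OF that(1)]] that(2) by blast
  have cover: "open_cover M \<W>"
    unfolding open_cover_def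
  proof (intro conjI ballI equalityI subsetI)
    show "x \<in> \<Union>\<W>" if "x \<in> topspace M" for x
      using ex_good[OF that] by (auto simp: \<W>_def)
  qed (use Wo WM in auto)
  have ref: "refinement_map \<W> \<U> (\<lambda>W. V (I W))"
    unfolding refinement_map_def using V In WV by blast
  \<comment> \<open>The transition rule gives \<open>\<theta> B = \<theta> A + S (I A) (I B)\<close>
    modulo integers, provided the same row is used on \<open>A\<close> and \<open>B\<close>.\<close>
  define N where "N = (\<lambda>A B x. \<theta> A x - \<theta> B x + S (I A) (I B) x)"
  have Nint: "\<exists>z::int. of_int z = N A B x" if A: "A \<in> \<W>" "x \<in> A" and B: "B \<in> \<W>" "x \<in> B" for A B x
  proof -
    have x: "x \<in> topspace M" "x \<in> V (I A)" "x \<in> V (I B)" using WM WV A B by blast+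
    have yAB: "y k (I B) x = y k (I A) x * g (I A) (I B) x" if "k < n" for k
      by (rule yg[OF that In[OF A(1)] In[OF B(1)] x])
    \<comment> \<open>two coordinates of a unit vector cannot both have square modulus above 1/2\<close>
    have same: "m A = m B"
    proof (rule ccontr)
      assume ne: "m A \<noteq> m B"
      have "(cmod (y (m A) (I A) x))\<^sup>2 + (cmod (y (m B) (I A) x))\<^sup>2 =
          (\<Sum>k\<in>{m A, m B}. (cmod (y k (I A) x))\<^sup>2)"
        using ne by simp
      also have "\<dots> \<le> (\<Sum>k<n. (cmod (y k (I A) x))\<^sup>2)"
        using mn A(1) B(1) by (intro sum_mono2) auto
      also have "\<dots> = 1" by (rule ysum[OF In[OF A(1)] x(1,2)])
      finally have "(cmod (y (m A) (I A) x))\<^sup>2 + (cmod (y (m B) (I A) x))\<^sup>2 \<le> 1" .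
      moreover have "cmod (y (m B) (I A) x) = cmod (y (m B) (I B) x)"
        using yAB[OF mn[OF B(1)]] by (simp add: norm_mult gnorm)
      ultimately show False using big[OF A] big[OF B] by simp
    qed
    define \<rho> where "\<rho> = cmod (y (m A) (I A) x)"
    have \<rho>: "\<rho> \<noteq> 0" using big[OF A] by (auto simp: \<rho>_def)
    have yB: "y (m B) (I B) x = y (m A) (I A) x * g (I A) (I B) x"
      using yAB[OF mn[OF A(1)]] by (simp add: same)
    then have "cmod (y (m B) (I B) x) = \<rho>" by (simp add: \<rho>_def norm_mult gnorm)
    with polar[OF B] have "y (m B) (I B) x = complex_of_real \<rho> * cis (2 * pi * \<theta> B x)" by simp
    moreover have "y (m A) (I A) x = complex_of_real \<rho> * cis (2 * pi * \<theta> A x)"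
      using polar[OF A] by (simp add: \<rho>_def)
    ultimately have "cis (2 * pi * \<theta> B x) = cis (2 * pi * \<theta> A x) * cis (2 * pi * S (I A) (I B) x)"
      using yB \<rho> by (simp add: g_def)
    then have "cis (2 * pi * \<theta> A x) * cis (2 * pi * S (I A) (I B) x) * cis (- (2 * pi * \<theta> B x)) = 1"
      by (metis add.right_inverse cis_mult cis_zero)
    then have "cis (2 * pi * N A B x) = 1"
      unfolding cis_mult by (simp add: N_def algebra_simps)
    then show ?thesis by (rule cis_2pi_eq_1_imp_int) blast
  qed
  have Nconst: "N A B x = N A B x'"
    if A: "A \<in> \<W>" "x \<in> A" "x' \<in> A" and B: "B \<in> \<W>" "x \<in> B" "x' \<in> B" for A B x x'
  proof -
    have "\<bar>S (I A) (I B) x - S (I A) (I B) x'\<bar> =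
        \<bar>\<Sum>k<n. (\<phi> k x - \<phi> k x') * real_of_int (c [V k, V (I A), V (I B)])\<bar>"
      by (simp add: S_def sum_subtractf left_diff_distrib)
    also have "\<dots> \<le> (\<Sum>k<n. \<bar>\<phi> k x - \<phi> k x'\<bar> * \<bar>real_of_int (c [V k, V (I A), V (I B)])\<bar>)"
      unfolding abs_mult[symmetric] by (rule sum_abs)
    also have "\<dots> \<le> (\<Sum>k<n. \<bar>\<phi> k x - \<phi> k x'\<bar> * C)"
      using cC In A(1) B(1) by (intro sum_mono mult_left_mono) auto
    also have "\<dots> = (\<Sum>k<n. \<bar>\<phi> k x - \<phi> k x'\<bar>) * C" by (simp add: sum_distrib_right)
    also have "\<dots> \<le> 1 / (8 * C) * C"
      using \<phi>var[OF A] C0 by (intro mult_right_mono) auto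
    also have "\<dots> = 1 / 8" using C0 by simp
    finally have Svar: "\<bar>S (I A) (I B) x - S (I A) (I B) x'\<bar> \<le> 1 / 8" .
    \<comment> \<open>The three terms vary by at most 1/8 each, too little to pass between different
      integers.\<close>
    have "N A B x - N A B x' = (\<theta> A x - \<theta> A x') - (\<theta> B x - \<theta> B x') + (S (I A) (I B) x - S (I A) (I B) x')"
      by (simp add: N_def)
    then have lt: "\<bar>N A B x - N A B x'\<bar> < 1"
      using \<theta>var[OF A] \<theta>var[OF B] Svar by linarith
    obtain z z' :: int where z: "of_int z = N A B x" "of_int z' = N A B x'"
      using Nint[OF A(1,2) B(1,2)] Nint[OF A(1,3) B(1,3)] by blast
    have "real_of_int \<bar>z - z'\<bar> < 1" using lt by (simp add: z)
    then have "z = z'" by (simp only: of_int_less_1_iff)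
    then show ?thesis using z by simp
  qed
  \<comment> \<open>The chosen point is immaterial since \<open>N\<close> is constant on the
    intersection; the floor only turns an integral real into an \<open>int\<close>.\<close>
  define b where "b = (\<lambda>s. if s \<in> nerve_simplices \<W> 1
    then \<lfloor>N (s ! 0) (s ! 1) (SOME x. x \<in> \<Inter>(set s))\<rfloor> else 0)"
  have b: "real_of_int (b [A, B]) = N A B x" if A: "A \<in> \<W>" "x \<in> A" and B: "B \<in> \<W>" "x \<in> B" for A B x
  proof -
    have s: "[A, B] \<in> nerve_simplices \<W> 1" using A B by (auto simp: nerve_simplices_def)
    define x' where "x' = (SOME x. x \<in> \<Inter>(set [A, B]))"
    have "x \<in> \<Inter>(set [A, B])" using A B by simp
    then have "x' \<in> \<Inter>(set [A, B])" unfolding x'_def by (rule someI)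
    then have x': "x' \<in> A" "x' \<in> B" by simp_all
    obtain z :: int where z: "of_int z = N A B x'" using Nint[OF A(1) x'(1) B(1) x'(2)] by blast
    have "b [A, B] = \<lfloor>N A B x'\<rfloor>" using s by (simp add: b_def x'_def)
    then have "real_of_int (b [A, B]) = N A B x'" by (simp add: z[symmetric])
    then show ?thesis using Nconst[OF A(1) x'(1) A(2) B(1) x'(2) B(2)] by simp
  qed
  have "nerve_pullback \<W> 2 (\<lambda>W. V (I W)) c \<in> nerve_coboundaries \<W> 2"
  proof (rule coboundariesI[where b = b and m = 1])
    show "b \<in> nerve_cochains \<W> 1" by (simp add: nerve_cochains_def b_def)
    fix s
    show "nerve_pullback \<W> 2 (\<lambda>W. V (I W)) c s = (if s \<in> nerve_simplices \<W> 2 then dlt b s else 0)"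
    proof (cases "s \<in> nerve_simplices \<W> 2")
      case True
      then have "length s = Suc (Suc (Suc 0))" by (simp add: nerve_simplices_def)
      then obtain A B D where s: "s = [A, B, D]" by (auto simp: length_Suc_conv)
      obtain x where W: "A \<in> \<W>" "B \<in> \<W>" "D \<in> \<W>" and x: "x \<in> A" "x \<in> B" "x \<in> D"
        using True by (auto simp: nerve_simplices_def s)
      have xV: "x \<in> V (I A)" "x \<in> V (I B)" "x \<in> V (I D)" using x W WV by blast+
      \<comment> \<open>In this alternating sum the \<open>\<theta>\<close> terms cancel.\<close>
      have "real_of_int (dlt b s) = N B D x - N A D x + N A B x"
        by (simp add: s b[OF W(1) x(1) W(2) x(2)] b[OF W(1) x(1) W(3) x(3)] b[OF W(2) x(2) W(3) x(3)])
      also have "\<dots> = S (I B) (I D) x - S (I A) (I D) x + S (I A) (I B) x"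
        by (simp add: N_def)
      also have "\<dots> = real_of_int (c [V (I A), V (I B), V (I D)])"
        by (rule SSS[OF In[OF W(1)] In[OF W(2)] In[OF W(3)] WM[OF W(1) x(1)] xV])
      finally have "dlt b s = c [V (I A), V (I B), V (I D)]" by (simp only: of_int_eq_iff)
      then show ?thesis using True by (simp add: nerve_pullback_def s)
    qed (simp add: nerve_pullback_def)
  qed simp
  then show ?thesis by (rule that[OF cover ref])
qed

text \<open>A class is zero once a representative becomes a coboundary on one refinement, since the
  zero cocycle pulls back to zero along the same map.\<close>

theorem approx_diagonal_trivial_cech_cohomology_2:
  assumes M: "compact_space M" "Hausdorff_space M" and AD: "approx_diagonal M"
  shows "trivial_group (cech_cohomology M 2)"
proof -
  interpret G: comm_group "cech_cohomology M 2"
    by (rule comm_group_cech_cohomology)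
  have "A = \<one>\<^bsub>cech_cohomology M 2\<^esub>" if A: "A \<in> carrier (cech_cohomology M 2)" for A
  proof -
    obtain \<U> c where c: "(\<U>, c) \<in> cech_cocycles M 2" "A = cech_class M 2 \<U> c"
      using A by (rule cech_carrierE)
    then have U: "open_cover M \<U>" and cU: "c \<in> nerve_cocycles \<U> 2"
      by (simp_all add: cech_cocycles_iff)
    have z: "(\<U>, \<lambda>_. 0) \<in> cech_cocycles M 2" using U by (simp add: cech_cocycles_iff zero_cocycle)
    obtain \<W> p where W: "open_cover M \<W>" "refinement_map \<W> \<U> p"
      "nerve_pullback \<W> 2 p c \<in> nerve_coboundaries \<W> 2"
      by (rule approx_diagonal_cocycle_refines_to_coboundary[OF M AD U cU])
    have "((\<U>, c), (\<U>, \<lambda>_. 0)) \<in> cech_rel M 2"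
    proof (rule cech_relI[OF c(1) z W(1,2,2)])
      have "(\<lambda>s. nerve_pullback \<W> 2 p c s - nerve_pullback \<W> 2 p (\<lambda>_. 0) s) = nerve_pullback \<W> 2 p c"
        by (simp add: nerve_pullback_def fun_eq_iff)
      then show "(\<lambda>s. nerve_pullback \<W> 2 p c s - nerve_pullback \<W> 2 p (\<lambda>_. 0) s) \<in> nerve_coboundaries \<W> 2"
        using W(3) by simp
    qed
    then show ?thesis
      unfolding cech_one[OF U] c(2) cech_class_eq_iff[OF c(1) z] .
  qed
  then show ?thesis
    unfolding trivial_group_def using G.is_group G.one_closed by blast
qed

theorem theorem3p4:
  fixes M :: "'a topology"
  assumes "compact_space M" and "Hausdorff_space M" and "approx_diagonal M"
  shows "covering_dim_le M 2 \<and> trivial_group (cech_cohomology M 2)"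
  using assms
  by (blast intro: approx_diagonal_covering_dim_le approx_diagonal_trivial_cech_cohomology_2)

end
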